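(* Consider the uncertain saturated nonlinear system, its differential algebraic representation (DAR) and the data $A_1,A_2,A_3,\Upsilon_1,\Upsilon_2,\Upsilon_3,C_1,C_2,\Sigma_1,\Sigma_2,\mathcal X,\mathcal D,a_k,\bar u$ described in the context. Assume that there exist $P\in\mathbb S_n^+$, $N\in\mathbb S_n^+$, $R\in\mathbb S_m^+$, a symmetric matrix $Q\in\mathbb R^{p\times p}$, a diagonal matrix $W\in\mathbb S_m^+$, matrices $S\in\mathbb R^{p\times m}$, $\mathfrak I\in\mathbb R^{(n+n_\pi+2m)\times n_\pi}$, $L_s\in\mathbb R^{(p+m)\times m}$, $Z\in\mathbb R^{n_{\pi_x}\times n_{\pi_x}}$, and matrices $\bar G(x,\delta)\in\mathbb R^{m\times n}$, $\bar G_\pi(x,\delta)\in\mathbb R^{m\times n_{\pi_x}}$ with affine dependence on $(x,\delta)$, such that for all $(x,\delta)$ at the vertices of $\mathcal X\times\mathcal D$ $$\Phi+\mathfrak I\,\Gamma+\Gamma^\top\mathfrak I^\top\prec 0,$$ $$\begin{bmatrix} P & \Sigma_1^\top Z^\top & \bar G_{(i)}^\top\\ \star & \Sigma_2^\top Z^\top+Z\Sigma_2 & \bar G_{\pi(i)}^\top\\ \star&\star&2W_{(i,i)}-\bar u_{(i)}^{-2}\end{bmatrix}\succeq 0,\qquad i=1,\dots,m,$$ and $$\begin{bmatrix} Q&\star\\ S^\top&R\end{bmatrix}+\mathrm{He}\left\{L_s\begin{bmatrix}S^\top&R\end{bmatrix}\right\}\prec 0,$$ $$\begin{bmatrix}P&a_k\\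 a_k^\top&1\end{bmatrix}\succeq 0,\qquad k=1,\dots,n_{xe},$$ hold, where $\Gamma=\begin{bmatrix}\Upsilon_1&\Upsilon_2&\Upsilon_3&\Upsilon_3\end{bmatrix}$ and $$\Phi=\begin{bmatrix}\mathrm{He}\{PA_1\}+N-C_1^\top QC_1&\star&\star&\star\\ A_2^\top P-C_2^\top QC_1&-C_2^\top QC_2&\star&\star\\ A_3^\top P-S^\top C_1&-S^\top C_2&-R&\star\\ A_3^\top P+\bar G&\begin{bmatrix}\bar G_\pi&0\end{bmatrix}&-W&-2W\end{bmatrix}.$$ Then the static output feedback gain $K=-R^{-1}S^\top$ (i.e. the control law $v(t)=Ky(t)$) asymptotically stabilizes the closed-loop system around the origin, and the ellipsoid $\varepsilon(P,1)=\{x\in\mathbb R^n:\ x^\top Px\le 1\}$ satisfies $\varepsilon(P,1)\subset\mathcal H\subset\mathbb R^n$, where $\mathcal H=\mathcal X\cap\mathcal L(\bar u)$ and $$\mathcal L(\bar u)=\{x\in\mathbb R^n:\ |G_{(i)}x+G_{\pi(i)}\pi_x|\le\bar u_{(i)},\ i=1,\dots,m\},\quad G=W^{-1}\bar G,\ G_\pi=W^{-1}\bar G_\pi,$$ and $\varepsilon(P,1)$ is an estimate of the closed-loop domain of attraction for all $\delta\in\mathcal D$.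
   Context: Notation: $\mathbb S_n^+$ is the set of $n\times n$ symmetric positive definite matrices; $\mathrm{He}\{A\}=A+A^\top$; $\star$ denotes blocks induced by symmetry; $W\succ Z$ (resp. $\succeq$) means $W-Z$ is positive definite (resp. semidefinite), and $W\prec Z$ means $Z\succ W$; a subscript $(i)$ denotes the $i$-th row of a matrix or $i$-th entry of a vector, $(i,i)$ the $i$-th diagonal entry. System: for $t\ge 0$, $$\dot x=f(x,\delta)+g(x,\delta)\,sat(v),\qquad y=h(x,\delta),$$ with state $x(t)\in\mathbb R^n$, $x(0)\in\mathcal X$, bounded time-varying parameters $\delta(t)\in\mathcal D\subset\mathbb R^l$ ($\mathcal D$ a given polytope), output $y(t)\in\mathbb R^p$, control $v(t)=Ky(t)\in\mathbb R^m$ with $K\in\mathbb R^{m\times p}$ (static output feedback), and decentralized saturation $sat(v_{(i)})=sign(v_{(i)})\min\{|v_{(i)}|,\bar u_{(i)}\}$, $\bar u_{(i)}>0$, $i=1,\dots,m$. The "closed-loop system" is this system with $v=Ky$. The set $\mathcal X\subset\mathbb R^n$ is a polytope containing the origin, $\mathcal X=\{x: a_k^\top x\le 1,\ k=1,\dots,n_{xe}\}$, with constant $a_k\in\mathbb R^n$. The functions $f,g,h$ are polynomial or rational in their arguments, of class $\mathcal C^1$, with $f(0,\delta)=0$, $h(0,\delta)=0$ for all $\delta\in\mathcal D$; the origin (zero state and zero input) is an equilibrium. The control $v(t)$ is measurable with values in a set $\mathcal V\subseteq\mathbb R^m$ containing $0$, and solutions exist and are unique for all $x(0)\in\mathcal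 X$. DAR: the system is equivalently written as $$\dot x=A_1x+A_2\pi+A_3\,sat(v),\quad 0=\Upsilon_1x+\Upsilon_2\pi+\Upsilon_3\,sat(v),\quad y=C_1x+C_2\pi,$$ where $\pi=\pi(x,sat(v),\delta)\in\mathbb R^{n_\pi}$ is a vector of nonlinear functions; $A_1\in\mathbb R^{n\times n}$, $A_2\in\mathbb R^{n\times n_\pi}$, $A_3\in\mathbb R^{n\times m}$, $\Upsilon_1\in\mathbb R^{n_\pi\times n}$, $\Upsilon_2\in\mathbb R^{n_\pi\times n_\pi}$, $\Upsilon_3\in\mathbb R^{n_\pi\times m}$ are affine functions of $(x,\delta)$; $\Upsilon_2(x,\delta)$ is invertible for all $(x,\delta)\in\mathcal X\times\mathcal D$; $C_1\in\mathbb R^{p\times n}$ and $C_2\in\mathbb R^{p\times n_\pi}$ are constant. The vector $\pi$ is partitioned as $\pi=[\pi_x^\top\ \pi_h^\top]^\top$, where $\pi_x\in\mathbb R^{n_{\pi_x}}$, $n_{\pi_x}\le n_\pi$, contains only terms of the state $x$ (so it is a function of $x$) and satisfies $0=\Sigma_1x+\Sigma_2\pi_x$ with $\Sigma_1\in\mathbb R^{n_{\pi_x}\times n}$, $\Sigma_2\in\mathbb R^{n_{\pi_x}\times n_{\pi_x}}$ affine in $(x,\delta)$. In $\Phi$, $[\bar G_\pi\ \ 0]\in\mathbb R^{m\times n_\pi}$ with a zero block of size $m\times(n_\pi-n_{\pi_x})$. The set $\mathcal L(\bar u)$ may depend on $\delta$ through $G,G_\pi$. An estimate of the closed-loop domain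 of attraction (for all $\delta\in\mathcal D$) is a set of initial conditions from which the closed-loop trajectories converge to the origin, whatever the admissible parameter trajectory $\delta(t)\in\mathcal D$. *)

theory Defs
  imports "HOL-Analysis.Analysis"
begin

section \<open>Matrices\<close>

definition pos_def :: "real^'k^'k \<Rightarrow> bool" where
  "pos_def M \<longleftrightarrow> transpose M = M \<and> (\<forall>z. z \<noteq> 0 \<longrightarrow> 0 < z \<bullet> (M *v z))"

definition pos_semidef :: "real^'k^'k \<Rightarrow> bool" where
  "pos_semidef M \<longleftrightarrow> transpose M = M \<and> (\<forall>z. 0 \<le> z \<bullet> (M *v z))"

definition neg_def :: "real^'k^'k \<Rightarrow> bool" where
  "neg_def M \<longleftrightarrow> pos_def (- M)"

definition diagonal_mat :: "real^'k^'k \<Rightarrow> bool" where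
  "diagonal_mat M \<longleftrightarrow> (\<forall>i j. i \<noteq> j \<longrightarrow> M $ i $ j = 0)"

definition He :: "real^'k^'k \<Rightarrow> real^'k^'k" where
  "He M = M + transpose M"

text \<open>A matrix with c + d columns is indexed by the sum of the two column index types; likewise
  for rows. \<open>A <|> B\<close> is $[A\ B]$, and \<open>A <~> B\<close> puts \<open>A\<close> on top of \<open>B\<close>.\<close>

definition hcat :: "real^'c^'r \<Rightarrow> real^'d^'r \<Rightarrow> real^('c + 'd)^'r" (infixr "<|>" 60) where
  "A <|> B = (\<chi> i j. case j of Inl k \<Rightarrow> A $ i $ k | Inr k \<Rightarrow> B $ i $ k)"

definition vcat :: "real^'c^'r \<Rightarrow> real^'c^'s \<Rightarrow> real^'c^('r + 's)" (infixr "<~>" 55) where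
  "A <~> B = (\<chi> i. case i of Inl k \<Rightarrow> A $ k | Inr k \<Rightarrow> B $ k)"

text \<open>\<open>sym_block A B C\<close> is the symmetric block matrix with diagonal blocks \<open>A\<close>, \<open>C\<close> and lower left
  block \<open>B\<close>; the upper right block (written as a star in the literature) is the transpose of \<open>B\<close>.\<close>

definition sym_block :: "real^'c^'c \<Rightarrow> real^'c^'d \<Rightarrow> real^'d^'d \<Rightarrow> real^('c + 'd)^('c + 'd)" where
  "sym_block A B C = ((A <|> transpose B) <~> (B <|> C))"

definition affine_map :: "('a::real_vector \<Rightarrow> 'b::real_vector) \<Rightarrow> bool" where
  "affine_map F \<longleftrightarrow> (\<exists>L c. linear L \<and> (\<forall>z. F z = L z + c))"

section \<open>Rational and continuously differentiable functions\<close>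

text \<open>\<open>q\<close> is a nonzero polynomial, hence nonzero on a dense subset of an open \<open>\<Omega>\<close>. Where \<open>q\<close>
  vanishes, \<open>F\<close> is only constrained by its continuity, which is assumed separately.\<close>

definition rational_on :: "'a::euclidean_space set \<Rightarrow> ('a \<Rightarrow> 'b::euclidean_space) \<Rightarrow> bool" where
  "rational_on \<Omega> F \<longleftrightarrow> (\<forall>b\<in>Basis. \<exists>p q.
     real_polynomial_function p \<and> real_polynomial_function q \<and> (\<exists>z. q z \<noteq> 0) \<and>
     (\<forall>z\<in>\<Omega>. q z \<noteq> 0 \<longrightarrow> F z \<bullet> b = p z / q z))"

definition C1_on :: "'a::euclidean_space set \<Rightarrow> ('a \<Rightarrow> 'b::euclidean_space) \<Rightarrow> bool" where
  "C1_on \<Omega> F \<longleftrightarrow> (\<exists>F' :: 'a \<Rightarrow> 'a \<Rightarrow>\<^sub>L 'b.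
     (\<forall>z\<in>\<Omega>. (F has_derivative blinfun_apply (F' z)) (at z)) \<and> continuous_on \<Omega> F')"

section \<open>Saturated systems\<close>

definition sat :: "real^'m \<Rightarrow> real^'m \<Rightarrow> real^'m" where
  "sat ubar v = (\<chi> i. sgn (v $ i) * min \<bar>v $ i\<bar> (ubar $ i))"

definition admissible_params :: "(real^'l) set \<Rightarrow> (real \<Rightarrow> real^'l) set" where
  "admissible_params D = {\<delta>. \<delta> \<in> borel_measurable (lebesgue_on {0..}) \<and> (\<forall>t\<ge>0. \<delta> t \<in> D)}"

text \<open>Controls and parameters are only measurable in time, so \<open>x' = f(x,\<delta>) + g(x,\<delta>) sat(v)\<close> is
  understood in the sense of Caratheodory, i.e. in integrated form. Here \<open>\<Omega>\<close> is the set on which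
  \<open>f\<close>, \<open>g\<close>, \<open>h\<close> are given, \<open>V\<close> is the set of control values, and \<open>I\<close> is a time
  interval \<open>{0..<T}\<close> or \<open>{0..}\<close>.\<close>

definition system_solution ::
  "((real^'n) \<times> (real^'l)) set \<Rightarrow> (real^'n \<Rightarrow> real^'l \<Rightarrow> real^'n) \<Rightarrow> (real^'n \<Rightarrow> real^'l \<Rightarrow> real^'m^'n) \<Rightarrow>
   real^'m \<Rightarrow> (real^'m) set \<Rightarrow> (real \<Rightarrow> real^'l) \<Rightarrow> (real \<Rightarrow> real^'m) \<Rightarrow> real set \<Rightarrow>
   (real \<Rightarrow> real^'n) \<Rightarrow> bool" where
  "system_solution \<Omega> f g ubar V \<delta> v I x \<longleftrightarrow>
     v \<in> borel_measurable (lebesgue_on I) \<and> (\<forall>t\<in>I. v t \<in> V) \<and> (\<forall>t\<in>I. (x t, \<delta> t) \<in> \<Omega>) \<and>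
     (\<forall>t\<in>I.
        (\<lambda>s. f (x s) (\<delta> s) + g (x s) (\<delta> s) *v sat ubar (v s)) absolutely_integrable_on {0..t} \<and>
        x t = x 0 + integral {0..t} (\<lambda>s. f (x s) (\<delta> s) + g (x s) (\<delta> s) *v sat ubar (v s)))"

definition closed_loop_solution ::
  "((real^'n) \<times> (real^'l)) set \<Rightarrow> (real^'n \<Rightarrow> real^'l \<Rightarrow> real^'n) \<Rightarrow> (real^'n \<Rightarrow> real^'l \<Rightarrow> real^'m^'n) \<Rightarrow>
   (real^'n \<Rightarrow> real^'l \<Rightarrow> real^'p) \<Rightarrow> real^'m \<Rightarrow> (real^'m) set \<Rightarrow> real^'p^'m \<Rightarrow>
   (real \<Rightarrow> real^'l) \<Rightarrow> real set \<Rightarrow> (real \<Rightarrow> real^'n) \<Rightarrow> bool" where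
  "closed_loop_solution \<Omega> f g h ubar V K \<delta> I x \<longleftrightarrow>
     system_solution \<Omega> f g ubar V \<delta> (\<lambda>t. K *v h (x t) (\<delta> t)) I x"

text \<open>Existence is only local in time: a trajectory starting in \<open>X\<close> may leave \<open>\<Omega>\<close> or blow up.\<close>

definition closed_loop_well_posed ::
  "((real^'n) \<times> (real^'l)) set \<Rightarrow> (real^'n \<Rightarrow> real^'l \<Rightarrow> real^'n) \<Rightarrow> (real^'n \<Rightarrow> real^'l \<Rightarrow> real^'m^'n) \<Rightarrow>
   (real^'n \<Rightarrow> real^'l \<Rightarrow> real^'p) \<Rightarrow> real^'m \<Rightarrow> (real^'m) set \<Rightarrow> real^'p^'m \<Rightarrow>
   (real^'n) set \<Rightarrow> (real^'l) set \<Rightarrow> bool" where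
  "closed_loop_well_posed \<Omega> f g h ubar V K X D \<longleftrightarrow>
     (\<forall>\<delta>\<in>admissible_params D. \<forall>x0\<in>X.
        (\<exists>T>0. \<exists>x. closed_loop_solution \<Omega> f g h ubar V K \<delta> {0..<T} x \<and> x 0 = x0) \<and>
        (\<forall>T x z. closed_loop_solution \<Omega> f g h ubar V K \<delta> {0..<T} x \<and> x 0 = x0 \<and>
                 closed_loop_solution \<Omega> f g h ubar V K \<delta> {0..<T} z \<and> z 0 = x0 \<longrightarrow>
                 (\<forall>t\<in>{0..<T}. x t = z t)))"

section \<open>Stability\<close>

text \<open>\<open>sol \<delta> x\<close> says that \<open>x\<close> is a trajectory on \<open>{0..}\<close> under the parameter trajectory \<open>\<delta>\<close>, and
  \<open>\<Delta>\<close> is the set of admissible parameter trajectories.\<close>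

definition attraction_estimate ::
  "('d \<Rightarrow> (real \<Rightarrow> 'a::real_normed_vector) \<Rightarrow> bool) \<Rightarrow> 'd set \<Rightarrow> 'a set \<Rightarrow> bool" where
  "attraction_estimate sol \<Delta> E \<longleftrightarrow>
     (\<forall>\<delta>\<in>\<Delta>. \<forall>x0\<in>E. (\<exists>x. sol \<delta> x \<and> x 0 = x0) \<and>
        (\<forall>x. sol \<delta> x \<and> x 0 = x0 \<longrightarrow> (x \<longlongrightarrow> 0) at_top))"

definition asymptotically_stable ::
  "('d \<Rightarrow> (real \<Rightarrow> 'a::real_normed_vector) \<Rightarrow> bool) \<Rightarrow> 'd set \<Rightarrow> bool" where
  "asymptotically_stable sol \<Delta> \<longleftrightarrow>
     (\<forall>e>0. \<exists>r>0. \<forall>\<delta>\<in>\<Delta>. \<forall>x. sol \<delta> x \<and> norm (x 0) < r \<longrightarrow> (\<forall>t\<ge>0. norm (x t) < e)) \<and>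
     (\<exists>r>0. attraction_estimate sol \<Delta> (ball 0 r))"

definition ellipsoid :: "real^'n^'n \<Rightarrow> real \<Rightarrow> (real^'n) set" where
  "ellipsoid P c = {x. x \<bullet> (P *v x) \<le> c}"

definition sat_region ::
  "real^'m \<Rightarrow> (real^'n \<Rightarrow> real^'n^'m) \<Rightarrow> (real^'n \<Rightarrow> real^'r^'m) \<Rightarrow> (real^'n \<Rightarrow> real^'r) \<Rightarrow>
   (real^'n) set" where
  "sat_region ubar G G\<pi> \<pi>x = {x. \<forall>i. \<bar>(G x *v x + G\<pi> x *v \<pi>x x) $ i\<bar> \<le> ubar $ i}"

section \<open>The matrix inequalities\<close>

text \<open>The entries of \<open>\<pi>\<close> that form \<open>\<pi>x\<close> are selected by an injection \<open>\<iota>\<close> of index types, not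
  necessarily onto a proper subset. \<open>pad_columns \<iota> M\<close> is the matrix $[M\ 0]$ acting on all
  of \<open>\<pi>\<close>, with the columns of \<open>M\<close> at the positions selected by \<open>\<iota>\<close>.\<close>

definition pad_columns :: "('r \<Rightarrow> 'q) \<Rightarrow> real^'r^'m \<Rightarrow> real^'q^'m" where
  "pad_columns \<iota> M = (\<chi> i j. if j \<in> range \<iota> then M $ i $ (inv \<iota> j) else 0)"

definition Gamma_mat ::
  "real^'n^'q \<Rightarrow> real^'q^'q \<Rightarrow> real^'m^'q \<Rightarrow> real^('n + ('q + ('m + 'm)))^'q" where
  "Gamma_mat \<Upsilon>1 \<Upsilon>2 \<Upsilon>3 = (\<Upsilon>1 <|> \<Upsilon>2 <|> \<Upsilon>3 <|> \<Upsilon>3)"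

text \<open>In \<open>Phi_mat\<close> the argument \<open>H\<close> stands for the padded matrix $[\bar G_\pi\ 0]$.\<close>

definition Phi_mat ::
  "real^'n^'n \<Rightarrow> real^'n^'n \<Rightarrow> real^'m^'m \<Rightarrow> real^'p^'p \<Rightarrow> real^'m^'m \<Rightarrow> real^'m^'p \<Rightarrow>
   real^'n^'n \<Rightarrow> real^'q^'n \<Rightarrow> real^'m^'n \<Rightarrow> real^'n^'p \<Rightarrow> real^'q^'p \<Rightarrow>
   real^'n^'m \<Rightarrow> real^'q^'m \<Rightarrow>
   real^('n + ('q + ('m + 'm)))^('n + ('q + ('m + 'm)))" where
  "Phi_mat P N R Q W S A1 A2 A3 C1 C2 G H =
     sym_block
       (He (P ** A1) + N - transpose C1 ** Q ** C1)
       ((transpose A2 ** P - transpose C2 ** Q ** C1) <~>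
        (transpose A3 ** P - transpose S ** C1) <~>
        (transpose A3 ** P + G))
       (sym_block
          (- (transpose C2 ** Q ** C2))
          (- (transpose S ** C2) <~> H)
          (sym_block (- R) (- W) (- (2 *\<^sub>R W))))"

end

theory Submission
  imports Defs
begin

text \<open>
  The function $V(x) = x^T P x$ is a Lyapunov function for the closed loop on its unit sublevel set, the
  ellipsoid \<open>ellipsoid P 1\<close>; everything else follows from that.

  For a fixed vector the quadratic form of each vertex inequality is affine in $(x, \delta)$,
  so the inequalities hold on all of \<open>X \<times> D\<close> (lemmas \<open>stability_lmi_on_polytope\<close> and
  \<open>saturation_lmi_on_polytope\<close>). They are then evaluated at well-chosen vectors. The fourth inequality
  puts the ellipsoid inside \<open>X\<close>, and the second shows that the auxiliary signal
  $\theta = G x + G_\pi \pi_x$ stays within the saturation levels there (\<open>saturation_bound\<close>). For such a \<open>\<theta>\<close> the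
  saturation defect $\psi = \mathrm{sat}(v) - v$ satisfies the sector condition
  $\psi_i\,(\theta_i - \mathrm{sat}(v)_i) \geq 0$. The first inequality, evaluated at $(x, \pi, v, \psi)$, then says that the
  derivative of \<open>V\<close> is at most $-x^T N x$ plus $y^T Q y + 2 v^T S^T y + v^T R v$ minus a sector term; the third
  inequality makes that quadratic expression nonpositive, because the chosen gain gives
  $R v = -S^T y$ (\<open>saturated_dissipation\<close>).

  The passage from this pointwise inequality to trajectories is delicate because parameters are only
  measurable in time. By the symmetry of \<open>P\<close>,
  $V(x(s)) - V(x(t)) = (x(s) - x(t))^T P (x(s) + x(t))$, and $x(s) - x(t)$ is the integral of the velocity. At
  a given nonzero state the derivative of \<open>V\<close> is strictly below $-x^T N x / 2$ for all parameters in the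
  compact set \<open>D\<close>, so by the tube lemma such a bound persists near that state, uniformly in the parameters. Hence \<open>V\<close> decreases
  to the right of every instant at a definite rate (\<open>lyap_local_decay\<close>), which yields invariance of the
  ellipsoid and all its sublevel sets, stability, and a bound on the time that a trajectory can spend above
  a given level (\<open>lyap_decay_time\<close>), hence convergence. Since the velocity is bounded on the ellipsoid,
  a local solution has a limit at the end of its domain and can be restarted there
  (\<open>global_solution\<close>).
\<close>

section \<open>Block vectors and quadratic forms\<close>

definition stack :: "real^'a \<Rightarrow> real^'b \<Rightarrow> real^('a + 'b)" (infixr "\<oplus>\<^sub>v" 70) where
  "u \<oplus>\<^sub>v v = (\<chi> i. case i of Inl k \<Rightarrow> u $ k | Inr k \<Rightarrow> v $ k)"

lemma sum_UNIV_Plus: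
  fixes F :: "'a::finite + 'b::finite \<Rightarrow> 'c::comm_monoid_add"
  shows "(\<Sum>i\<in>UNIV. F i) = (\<Sum>k\<in>UNIV. F (Inl k)) + (\<Sum>k\<in>UNIV. F (Inr k))"
  by (simp add: sum.Plus flip: UNIV_Plus_UNIV)

lemma inner_stack [simp]: "(u \<oplus>\<^sub>v v) \<bullet> (u' \<oplus>\<^sub>v v') = u \<bullet> u' + v \<bullet> v'"
  by (simp add: inner_vec_def stack_def sum_UNIV_Plus)

lemma hcat_mult_stack [simp]: "(A <|> B) *v (u \<oplus>\<^sub>v v) = A *v u + B *v v"
  by (simp add: vec_eq_iff matrix_vector_mult_def stack_def hcat_def sum_UNIV_Plus)

lemma vcat_mult [simp]: "(A <~> B) *v z = (A *v z) \<oplus>\<^sub>v (B *v z)"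
  by (simp add: vec_eq_iff matrix_vector_mult_def stack_def vcat_def split: sum.split)

lemma inner_transpose_mult: "u \<bullet> (transpose A *v v) = v \<bullet> ((A::real^'a^'b) *v u)"
  by (metis dot_lmul_matrix inner_commute transpose_matrix_vector)

lemma quadratic_form_sym_block:
  "(u \<oplus>\<^sub>v v) \<bullet> (sym_block A B C *v (u \<oplus>\<^sub>v v)) = u \<bullet> (A *v u) + 2 * (v \<bullet> (B *v u)) + v \<bullet> (C *v v)"
  by (simp add: sym_block_def inner_transpose_mult inner_right_distrib del: transpose_matrix_vector)

lemma quadratic_form_He: "u \<bullet> (He A *v u) = 2 * (u \<bullet> (A *v u))"
  by (simp add: He_def matrix_vector_mult_add_rdistrib inner_transpose_mult inner_right_distrib
      del: transpose_matrix_vector)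

lemma uminus_matrix_vector_mult: "(- M) *v z = - ((M::real^'a^'b) *v z)"
  by (simp add: vec_eq_iff matrix_vector_mult_def sum_negf)

lemma neg_def_quadratic_form: "neg_def M \<Longrightarrow> z \<bullet> (M *v z) \<le> 0"
proof -
  assume "neg_def M"
  moreover have "(- M) *v z = - (M *v z)" by (rule uminus_matrix_vector_mult)
  ultimately show ?thesis
    by (cases "z = 0") (fastforce simp: neg_def_def pos_def_def)+
qed

lemma inner_sym_mult: "transpose M = M \<Longrightarrow> u \<bullet> (M *v v) = v \<bullet> ((M::real^'a^'a) *v u)"
  by (metis inner_transpose_mult)

lemma diagonal_mat_mult: "diagonal_mat W \<Longrightarrow> (W *v z) $ i = W $ i $ i * (z::real^'m) $ i"
proof -
  assume "diagonal_mat W"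
  then have "(\<Sum>j\<in>UNIV. W $ i $ j * z $ j) = (\<Sum>j\<in>{i}. W $ i $ j * z $ j)"
    by (intro sum.mono_neutral_right) (auto simp: diagonal_mat_def)
  then show ?thesis by (simp add: matrix_vector_mult_def)
qed

lemma pos_def_diagonal_pos: "pos_def W \<Longrightarrow> 0 < W $ i $ i"
proof -
  assume "pos_def W"
  then have "0 < axis i 1 \<bullet> (W *v axis i 1)"
    unfolding pos_def_def by (simp add: axis_eq_0_iff)
  then show ?thesis
    by (simp add: inner_axis' matrix_vector_mult_basis column_def)
qed

lemma pos_def_mult_matrix_inv:
  assumes "pos_def M"
  shows "M ** matrix_inv M = mat 1"
proof -
  have "z = 0" if "M *v z = 0" for z
  proof (rule ccontr)
    assume "z \<noteq> 0"
    then have "0 < z \<bullet> (M *v z)" using assms by (simp add: pos_def_def)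
    then show False by (simp add: that)
  qed
  then have "invertible M"
    by (simp add: invertible_left_inverse matrix_left_invertible_ker)
  then show ?thesis
    unfolding invertible_def matrix_inv_def by (rule someI2_ex) blast
qed

text \<open>Only the entries of \<open>p\<close> that make up \<open>\<pi>\<^sub>x\<close> meet a nonzero column.\<close>

lemma pad_columns_mult:
  fixes \<iota> :: "'r::finite \<Rightarrow> 'q::finite"
  assumes "inj \<iota>"
  shows "pad_columns \<iota> M *v p = M *v (\<chi> j. p $ \<iota> j)"
proof -
  have "(\<Sum>j\<in>UNIV. pad_columns \<iota> M $ i $ j * p $ j) = (\<Sum>j\<in>UNIV. M $ i $ j * p $ \<iota> j)" for i
  proof -
    have "(\<Sum>j\<in>UNIV. pad_columns \<iota> M $ i $ j * p $ j)
        = (\<Sum>j\<in>range \<iota>. pad_columns \<iota> M $ i $ j * p $ j)"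
      by (rule sum.mono_neutral_right) (auto simp: pad_columns_def)
    also have "\<dots> = (\<Sum>j\<in>UNIV. M $ i $ j * p $ \<iota> j)"
      using assms by (subst sum.reindex) (auto simp: pad_columns_def)
    finally show ?thesis .
  qed
  then show ?thesis
    by (simp add: vec_eq_iff matrix_vector_mult_def)
qed

lemma rowvector_mult: "rowvector (r::real^'a) *v z = vec (r \<bullet> z)"
  by (simp add: vec_eq_iff rowvector_def matrix_vector_mult_def inner_vec_def)

lemma mat1_mult: "(mat c :: real^1^1) *v vec s = vec (c * s)"
  by (simp add: vec_eq_iff mat_def matrix_vector_mult_def)

lemma inner_vec1: "(vec s :: real^1) \<bullet> vec t = s * t"
  by (simp add: inner_vec_def)

section \<open>Affine functions on polytopes\<close>

lemma affine_map_const: "affine_map (\<lambda>z. c)"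
  unfolding affine_map_def by (intro exI[of _ "\<lambda>z. 0"]) (auto simp: linear_zero)

lemma affine_map_linear_compose: "linear L \<Longrightarrow> affine_map F \<Longrightarrow> affine_map (\<lambda>z. L (F z))"
  unfolding affine_map_def
proof clarify
  fix M c assume "linear L" "linear M" "\<forall>z. F z = M z + c"
  then show "\<exists>L' c. linear L' \<and> (\<forall>z. L (F z) = L' z + c)"
    by (intro exI[of _ "L \<circ> M"] exI[of _ "L c"]) (auto simp: linear_compose linear_add)
qed

lemma affine_map_add:
  assumes "affine_map F" "affine_map G"
  shows "affine_map (\<lambda>z. F z + G z)"
proof -
  obtain L c M d where "linear L" "\<forall>z. F z = L z + c" "linear M" "\<forall>z. G z = M z + d"
    using assms unfolding affine_map_def by blast
  then show ?thesis
    unfolding affine_map_def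
    by (intro exI[of _ "\<lambda>z. L z + M z"] exI[of _ "c + d"]) (auto simp: linear_compose_add algebra_simps)
qed

lemma affine_map_diff:
  assumes "affine_map F" "affine_map G"
  shows "affine_map (\<lambda>z. F z - G z)"
proof -
  have "affine_map (\<lambda>z. - G z)"
    by (rule affine_map_linear_compose[OF _ assms(2)]) (simp add: linear_uminus)
  from affine_map_add[OF assms(1) this] show ?thesis by simp
qed

lemma affine_map_cmult: "affine_map F \<Longrightarrow> affine_map (\<lambda>z. c * F z :: real)"
  by (rule affine_map_linear_compose[of "(*) c"]) (auto simp: linear_iff algebra_simps)

lemma affine_map_inner_right: "affine_map F \<Longrightarrow> affine_map (\<lambda>z. u \<bullet> F z)"
  by (rule affine_map_linear_compose[of "(\<bullet>) u"])
    (auto intro: bounded_linear.linear bounded_linear_inner_right)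

lemma affine_map_inner_left: "affine_map F \<Longrightarrow> affine_map (\<lambda>z. F z \<bullet> u)"
  by (simp add: inner_commute[of _ u] affine_map_inner_right)

lemma affine_map_matrix_mult: "affine_map F \<Longrightarrow> affine_map (\<lambda>z. (M :: real^'j^'i) *v F z)"
  by (rule affine_map_linear_compose[OF matrix_vector_mul_linear])

lemma affine_map_apply:
  fixes A :: "'a::real_vector \<Rightarrow> 'b::real_vector \<Rightarrow> real^'j^'i"
  assumes "affine_map (case_prod A)"
  shows "affine_map (\<lambda>z. A (fst z) (snd z) *v u)"
proof -
  have "linear (\<lambda>M :: real^'j^'i. M *v u)"
    by (rule linearI) (simp_all add: matrix_vector_mult_add_rdistrib flip: scaleR_matrix_vector_assoc)
  from affine_map_linear_compose[OF this assms] show ?thesis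
    by (simp add: case_prod_beta)
qed

lemma affine_map_row:
  fixes A :: "'a::real_vector \<Rightarrow> 'b::real_vector \<Rightarrow> real^'j^'i"
  assumes "affine_map (case_prod A)"
  shows "affine_map (\<lambda>z. (A (fst z) (snd z) $ i) \<bullet> u)"
proof -
  have "linear (\<lambda>M :: real^'j^'i. (M $ i) \<bullet> u)"
    by (rule linearI) (simp_all add: inner_left_distrib)
  from affine_map_linear_compose[OF this assms] show ?thesis
    by (simp add: case_prod_beta)
qed

lemmas affine_map_intros = affine_map_const affine_map_add affine_map_diff affine_map_cmult
  affine_map_inner_right affine_map_inner_left affine_map_matrix_mult affine_map_apply affine_map_row

text \<open>A polytope is the convex hull of its vertices, and a sublevel set of an affine function is convex.
  This is what lets a matrix inequality be checked at the vertices only: for a \<^emph>\<open>fixed\<close> vector its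
  quadratic form is an affine function of the matrix.\<close>

lemma affine_le_on_polytope:
  fixes \<phi> :: "'a::euclidean_space \<Rightarrow> real"
  assumes "polytope C" "affine_map \<phi>" "\<And>z. z extreme_point_of C \<Longrightarrow> \<phi> z \<le> 0" "z \<in> C"
  shows "\<phi> z \<le> 0"
proof -
  obtain L c where L: "linear L" "\<And>z. \<phi> z = L z + c"
    using assms(2) unfolding affine_map_def by blast
  have "convex {z. \<phi> z \<le> 0}"
  proof -
    have "convex (L -` {.. - c})"
      by (rule convex_linear_vimage[OF L(1)]) simp
    moreover have "L -` {.. - c} = {z. \<phi> z \<le> 0}" by (auto simp: L(2))
    ultimately show ?thesis by simp
  qed
  moreover have "C = convex hull {z. z extreme_point_of C}"
    using assms(1) by (intro Krein_Milman_Minkowski) (auto intro: polytope_imp_compact polytope_imp_convex)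
  moreover have "{z. z extreme_point_of C} \<subseteq> {z. \<phi> z \<le> 0}"
    using assms(3) by auto
  ultimately show ?thesis
    using assms(4) hull_minimal by (metis (mono_tags, lifting) mem_Collect_eq subset_iff)
qed

section \<open>The matrix inequalities as quadratic forms\<close>

text \<open>The stability inequality evaluated at $(x, p, v, \psi)$, where \<open>\<psi>\<close> will be the saturation defect
  $\mathrm{sat}(v) - v$, so that \<open>v + \<psi>\<close> is the input that acts on the plant. Its terms are the derivative
  of $x^T P x$, the rate $x^T N x$, the output form bounded by the third inequality, the sector
  term, and a multiple of the algebraic constraint of the representation.\<close>

lemma quadratic_form_stability_lmi:
  fixes x :: "real^'n" and p :: "real^'q" and v \<psi> :: "real^'m"
    and C1 :: "real^'n^'p" and C2 :: "real^'q^'p"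
  assumes P: "transpose P = P" and Q: "transpose Q = Q"
  defines "\<zeta> \<equiv> x \<oplus>\<^sub>v p \<oplus>\<^sub>v v \<oplus>\<^sub>v \<psi>" and "y \<equiv> C1 *v x + C2 *v p"
  shows "\<zeta> \<bullet> ((Phi_mat P N R Q W S A1 A2 A3 C1 C2 G H + J ** Gamma_mat \<Upsilon>1 \<Upsilon>2 \<Upsilon>3
              + transpose (Gamma_mat \<Upsilon>1 \<Upsilon>2 \<Upsilon>3) ** transpose J) *v \<zeta>)
       = 2 * (x \<bullet> (P *v (A1 *v x + A2 *v p + A3 *v (v + \<psi>)))) + x \<bullet> (N *v x)
         - (y \<bullet> (Q *v y) + 2 * (v \<bullet> (transpose S *v y)) + v \<bullet> (R *v v))
         + 2 * (\<psi> \<bullet> (G *v x + H *v p - W *v (v + \<psi>)))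
         + 2 * ((\<Upsilon>1 *v x + \<Upsilon>2 *v p + \<Upsilon>3 *v (v + \<psi>)) \<bullet> (transpose J *v \<zeta>))"
proof -
  let ?\<Gamma> = "Gamma_mat \<Upsilon>1 \<Upsilon>2 \<Upsilon>3"
  have \<Gamma>: "?\<Gamma> *v \<zeta> = \<Upsilon>1 *v x + \<Upsilon>2 *v p + \<Upsilon>3 *v (v + \<psi>)"
    by (simp add: Gamma_mat_def \<zeta>_def matrix_vector_right_distrib add.assoc)
  have J: "\<zeta> \<bullet> (J *v (?\<Gamma> *v \<zeta>)) = (?\<Gamma> *v \<zeta>) \<bullet> (transpose J *v \<zeta>)"
    by (simp add: inner_transpose_mult del: transpose_matrix_vector)
  have J': "\<zeta> \<bullet> (transpose ?\<Gamma> *v (transpose J *v \<zeta>)) = (?\<Gamma> *v \<zeta>) \<bullet> (transpose J *v \<zeta>)"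
    by (metis inner_commute inner_transpose_mult)
  have PA: "u \<bullet> (transpose A *v (P *v x)) = x \<bullet> (P *v (A *v u))" for u :: "real^'c" and A
    by (metis P inner_commute inner_transpose_mult)
  have CQ: "u \<bullet> (transpose C *v (Q *v w)) = (C *v u) \<bullet> (Q *v w)" for u :: "real^'c" and C w
    by (metis inner_commute inner_transpose_mult)
  have QC: "(C2 *v p) \<bullet> (Q *v (C1 *v x)) = (C1 *v x) \<bullet> (Q *v (C2 *v p))"
    by (rule inner_sym_mult[OF Q])
  have \<Phi>: "\<zeta> \<bullet> (Phi_mat P N R Q W S A1 A2 A3 C1 C2 G H *v \<zeta>)
     = 2 * (x \<bullet> (P *v (A1 *v x + A2 *v p + A3 *v (v + \<psi>)))) + x \<bullet> (N *v x)
         - (y \<bullet> (Q *v y) + 2 * (v \<bullet> (transpose S *v y)) + v \<bullet> (R *v v))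
         + 2 * (\<psi> \<bullet> (G *v x + H *v p - W *v (v + \<psi>)))"
    unfolding Phi_mat_def \<zeta>_def y_def quadratic_form_sym_block
    by (simp add: quadratic_form_He matrix_vector_mult_add_rdistrib matrix_vector_mult_diff_rdistrib
        matrix_vector_right_distrib inner_add_left inner_add_right inner_diff_right
        uminus_matrix_vector_mult PA CQ QC
        flip: matrix_vector_mul_assoc scaleR_matrix_vector_assoc del: transpose_matrix_vector)
  show ?thesis
    by (simp add: matrix_vector_mult_add_rdistrib inner_add_right J[unfolded \<Gamma>] J'[unfolded \<Gamma>] \<Gamma> \<Phi>
        flip: matrix_vector_mul_assoc del: transpose_matrix_vector)
qed

text \<open>Here \<open>Z\<close> multiplies the algebraic constraint on \<open>\<pi>\<^sub>x\<close>, so that its terms vanish on the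
  constraint set.\<close>

lemma quadratic_form_saturation_lmi:
  "(x \<oplus>\<^sub>v r \<oplus>\<^sub>v vec s) \<bullet> (sym_block P (Z ** \<Sigma>1 <~> rowvector \<gamma>)
      (sym_block (transpose \<Sigma>2 ** transpose Z + Z ** \<Sigma>2) (rowvector \<gamma>') (mat c :: real^1^1))
      *v (x \<oplus>\<^sub>v r \<oplus>\<^sub>v vec s))
   = x \<bullet> (P *v x) + 2 * (r \<bullet> (Z *v (\<Sigma>1 *v x + \<Sigma>2 *v r))) + 2 * (s * (\<gamma> \<bullet> x + \<gamma>' \<bullet> r)) + s * (c * s)"
proof -
  have "r \<bullet> (transpose \<Sigma>2 *v (transpose Z *v r)) = r \<bullet> (Z *v (\<Sigma>2 *v r))"
    by (metis inner_commute inner_transpose_mult)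
  then show ?thesis
    by (simp add: quadratic_form_sym_block rowvector_mult mat1_mult inner_vec1
        matrix_vector_mult_add_rdistrib inner_add_right distrib_left matrix_vector_right_distrib
        flip: matrix_vector_mul_assoc del: transpose_matrix_vector)
qed

text \<open>The block form of the vector brings in the explicit quadratic form, in which each of the
  parameter-dependent matrices occurs affinely.\<close>

lemma stability_lmi_on_polytope:
  fixes X :: "'s::euclidean_space set" and D :: "'d::euclidean_space set"
  assumes XD: "polytope X" "polytope D" "x \<in> X" "\<delta> \<in> D"
    and affine: "affine_map (case_prod A1)" "affine_map (case_prod A2)" "affine_map (case_prod A3)"
      "affine_map (case_prod \<Upsilon>1)" "affine_map (case_prod \<Upsilon>2)" "affine_map (case_prod \<Upsilon>3)"
      "affine_map (case_prod G)" "affine_map (case_prod H)"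
    and "inj \<iota>" and sym: "transpose P = P" "transpose Q = Q"
    and lmi: "\<And>x \<delta>. (x, \<delta>) extreme_point_of (X \<times> D) \<Longrightarrow>
          neg_def (Phi_mat P N R Q W S (A1 x \<delta>) (A2 x \<delta>) (A3 x \<delta>) C1 C2 (G x \<delta>) (pad_columns \<iota> (H x \<delta>))
                   + J ** Gamma_mat (\<Upsilon>1 x \<delta>) (\<Upsilon>2 x \<delta>) (\<Upsilon>3 x \<delta>)
                   + transpose (Gamma_mat (\<Upsilon>1 x \<delta>) (\<Upsilon>2 x \<delta>) (\<Upsilon>3 x \<delta>)) ** transpose J)"
    and z: "z = \<xi> \<oplus>\<^sub>v p \<oplus>\<^sub>v v \<oplus>\<^sub>v \<psi>"
  shows "z \<bullet> ((Phi_mat P N R Q W S (A1 x \<delta>) (A2 x \<delta>) (A3 x \<delta>) C1 C2 (G x \<delta>) (pad_columns \<iota> (H x \<delta>))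
                   + J ** Gamma_mat (\<Upsilon>1 x \<delta>) (\<Upsilon>2 x \<delta>) (\<Upsilon>3 x \<delta>)
                   + transpose (Gamma_mat (\<Upsilon>1 x \<delta>) (\<Upsilon>2 x \<delta>) (\<Upsilon>3 x \<delta>)) ** transpose J) *v z) \<le> 0"
    (is "z \<bullet> (?M x \<delta> *v z) \<le> 0")
proof -
  have "affine_map (\<lambda>q. z \<bullet> (?M (fst q) (snd q) *v z))"
    unfolding z quadratic_form_stability_lmi[OF sym] pad_columns_mult[OF \<open>inj \<iota>\<close>]
    by (intro affine_map_intros affine)
  from affine_le_on_polytope[OF polytope_Times[OF XD(1,2)] this, of "(x, \<delta>)"] show ?thesis
    using XD(3,4) neg_def_quadratic_form[OF lmi] by fastforce
qed

lemma saturation_lmi_on_polytope: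
  fixes X :: "'s::euclidean_space set" and D :: "'d::euclidean_space set"
  assumes XD: "polytope X" "polytope D" "x \<in> X" "\<delta> \<in> D"
    and affine: "affine_map (case_prod \<Sigma>1)" "affine_map (case_prod \<Sigma>2)"
      "affine_map (case_prod G)" "affine_map (case_prod H)"
    and lmi: "\<And>x \<delta>. (x, \<delta>) extreme_point_of (X \<times> D) \<Longrightarrow>
          pos_semidef (sym_block P (Z ** \<Sigma>1 x \<delta> <~> rowvector (G x \<delta> $ i))
            (sym_block (transpose (\<Sigma>2 x \<delta>) ** transpose Z + Z ** \<Sigma>2 x \<delta>)
               (rowvector (H x \<delta> $ i)) (mat c :: real^1^1)))"
    and z: "z = \<xi> \<oplus>\<^sub>v r \<oplus>\<^sub>v vec s"
  shows "0 \<le> z \<bullet> (sym_block P (Z ** \<Sigma>1 x \<delta> <~> rowvector (G x \<delta> $ i))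
            (sym_block (transpose (\<Sigma>2 x \<delta>) ** transpose Z + Z ** \<Sigma>2 x \<delta>)
               (rowvector (H x \<delta> $ i)) (mat c :: real^1^1)) *v z)"
    (is "0 \<le> z \<bullet> (?M x \<delta> *v z)")
proof -
  have "affine_map (\<lambda>q. (- 1) * (z \<bullet> (?M (fst q) (snd q) *v z)))"
    unfolding z quadratic_form_saturation_lmi
    by (intro affine_map_intros affine)
  moreover have "(- 1) * (z \<bullet> (?M (fst q) (snd q) *v z)) \<le> 0" if "q extreme_point_of (X \<times> D)" for q
    using lmi[of "fst q" "snd q"] that by (simp add: pos_semidef_def)
  ultimately show ?thesis
    using affine_le_on_polytope[OF polytope_Times[OF XD(1,2)], of _ "(x, \<delta>)"] XD(3,4) by fastforce
qed

section \<open>Saturation and dissipation\<close>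

lemma sat_nth: "(sat u v) $ i = (if 0 \<le> v $ i then min (v $ i) (u $ i) else - min (- v $ i) (u $ i))"
   if "0 < u $ i"
  using that by (auto simp: sat_def sgn_if min_def)

text \<open>If the channel is saturated, then \<open>sat u v\<close> is the bound of the same sign as \<open>v\<close>: the
  defect points towards zero, while an admissible \<open>\<theta>\<close> lies on the inner side of that bound, so that both
  factors have the same sign.\<close>

lemma sector_condition:
  assumes "0 < u $ i" "\<bar>\<theta>\<bar> \<le> u $ i"
  shows "0 \<le> (sat u v $ i - v $ i) * (\<theta> - sat u v $ i)"
proof (cases "\<bar>v $ i\<bar> \<le> u $ i")
  case True
  then have "sat u v $ i = v $ i" using assms(1) by (auto simp: sat_nth)
  then show ?thesis by simp
next
  case False
  then consider "u $ i < v $ i" "sat u v $ i = u $ i" | "v $ i < - u $ i" "sat u v $ i = - u $ i"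
    using assms(1) by (fastforce simp: sat_nth split: if_splits)
  then show ?thesis
    using assms(2) by cases (auto intro: mult_nonpos_nonpos mult_nonneg_nonneg)
qed

text \<open>With $\psi = \mathrm{sat}(v) - v$ and $y = C_1 x + C_2 p$, the algebraic constraint removes the
  multiplier \<open>J\<close>. The feedback makes $S^T y + R v$ vanish, so the third matrix inequality loses its
  multiplier \<open>Ls\<close> and says that the output form is nonpositive at \<open>(y, v)\<close>. The sector term is
  nonnegative. The stability inequality therefore leaves the derivative of $x^T P x$ bounded
  by $-x^T N x$.\<close>

lemma saturated_dissipation:
  fixes x :: "real^'n" and p :: "real^'q" and v :: "real^'m" and C1 :: "real^'n^'p"
  assumes P: "transpose P = P" and Q: "transpose Q = Q"
    and W: "pos_def W" "diagonal_mat W" and u: "\<forall>i. 0 < u $ i"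
    and lmi1: "\<And>z. z = x \<oplus>\<^sub>v p \<oplus>\<^sub>v v \<oplus>\<^sub>v (sat u v - v) \<Longrightarrow>
          z \<bullet> ((Phi_mat P N R Q W S A1 A2 A3 C1 C2 G H + J ** Gamma_mat \<Upsilon>1 \<Upsilon>2 \<Upsilon>3
              + transpose (Gamma_mat \<Upsilon>1 \<Upsilon>2 \<Upsilon>3) ** transpose J) *v z) \<le> 0"
    and lmi3: "neg_def (sym_block Q (transpose S) R + He (Ls ** (transpose S <|> R)))"
    and dar: "\<Upsilon>1 *v x + \<Upsilon>2 *v p + \<Upsilon>3 *v sat u v = 0"
    and feedback: "R *v v = - (transpose S *v (C1 *v x + C2 *v p))"
    and \<theta>: "G *v x + H *v p = W *v \<theta>" "\<forall>i. \<bar>\<theta> $ i\<bar> \<le> u $ i"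
  shows "2 * (x \<bullet> (P *v (A1 *v x + A2 *v p + A3 *v sat u v))) \<le> - (x \<bullet> (N *v x))"
proof -
  let ?s = "sat u v" let ?y = "C1 *v x + C2 *v p"
  have "(?y \<oplus>\<^sub>v v) \<bullet> ((sym_block Q (transpose S) R + He (Ls ** (transpose S <|> R))) *v (?y \<oplus>\<^sub>v v)) \<le> 0"
    by (rule neg_def_quadratic_form[OF lmi3])
  moreover have "(transpose S <|> R) *v (?y \<oplus>\<^sub>v v) = 0"
    by (simp add: feedback del: transpose_matrix_vector)
  ultimately have out: "?y \<bullet> (Q *v ?y) + 2 * (v \<bullet> (transpose S *v ?y)) + v \<bullet> (R *v v) \<le> 0"
    by (simp add: matrix_vector_mult_add_rdistrib inner_add_right quadratic_form_sym_block
        quadratic_form_He flip: matrix_vector_mul_assoc del: transpose_matrix_vector)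
  have "(?s - v) \<bullet> (W *v (\<theta> - ?s)) = (\<Sum>i\<in>UNIV. W $ i $ i * ((?s $ i - v $ i) * (\<theta> $ i - ?s $ i)))"
    by (simp add: inner_vec_def diagonal_mat_mult[OF W(2)] mult_ac)
  also have "\<dots> \<ge> 0"
    using W(1) u \<theta>(2) by (intro sum_nonneg mult_nonneg_nonneg sector_condition)
      (auto intro: less_imp_le pos_def_diagonal_pos)
  finally have sector: "0 \<le> (?s - v) \<bullet> (G *v x + H *v p - W *v ?s)"
    by (simp add: \<theta>(1) matrix_vector_mult_diff_distrib)
  show ?thesis
    using lmi1[OF refl] out sector dar
    by (simp add: quadratic_form_stability_lmi[OF P Q] del: transpose_matrix_vector)
qed

text \<open>On the constraint set the inequality is a scalar one in the free entry \<open>s\<close>. At $s = -u$ and $s = u$ the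
  term $-s^2/u^2$ cancels the bound $x^T P x \leq 1$, and what is left is \<open>2 u w (u - \<theta>) \<ge> 0\<close> and \<open>2 u w (u + \<theta>) \<ge> 0\<close>.\<close>

lemma saturation_bound:
  fixes x :: "real^'n" and r :: "real^'r" and \<gamma> :: "real^'n"
  assumes lmi: "\<And>z s. z = x \<oplus>\<^sub>v r \<oplus>\<^sub>v vec s \<Longrightarrow> 0 \<le> z \<bullet> (sym_block P (Z ** \<Sigma>1 <~> rowvector \<gamma>)
        (sym_block (transpose \<Sigma>2 ** transpose Z + Z ** \<Sigma>2) (rowvector \<gamma>')
           (mat (2 * w - 1 / u\<^sup>2) :: real^1^1)) *v z)"
    and dar: "\<Sigma>1 *v x + \<Sigma>2 *v r = 0"
    and x: "x \<bullet> (P *v x) \<le> 1" and "0 < w" "0 < u"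
    and \<theta>: "\<gamma> \<bullet> x + \<gamma>' \<bullet> r = w * \<theta>"
  shows "\<bar>\<theta>\<bar> \<le> u"
proof -
  have form: "0 \<le> x \<bullet> (P *v x) + 2 * (s * (w * \<theta>)) + s * ((2 * w - 1 / u\<^sup>2) * s)" for s
    using lmi[OF refl, of s] by (simp only: quadratic_form_saturation_lmi dar \<theta>) simp
  have sq: "u * ((2 * w - 1 / u\<^sup>2) * u) = 2 * (u * w) * u - 1"
    using \<open>0 < u\<close> by (simp add: field_simps power2_eq_square)
  have "0 \<le> x \<bullet> (P *v x) - 2 * (u * (w * \<theta>)) + u * ((2 * w - 1 / u\<^sup>2) * u)"
    using form[of "- u"] by simp
  then have "0 \<le> 2 * (u * w) * (u - \<theta>)"
    unfolding sq using x by (simp add: algebra_simps)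
  moreover have "0 \<le> 2 * (u * w) * (u + \<theta>)"
    using form[of u] x unfolding sq by (simp add: algebra_simps)
  moreover have "0 < 2 * (u * w)"
    using \<open>0 < w\<close> \<open>0 < u\<close> by simp
  ultimately show ?thesis
    by (simp only: zero_le_mult_iff) linarith
qed

text \<open>At the vector $(x, -1)$ the form reads $x^T P x - 2 a^T x + 1$.\<close>

lemma ellipsoid_subset_halfspace:
  assumes "pos_semidef (sym_block P (rowvector a) (mat 1 :: real^1^1))" "x \<in> ellipsoid P 1"
  shows "a \<bullet> x \<le> 1"
proof -
  have "0 \<le> (x \<oplus>\<^sub>v vec (- 1)) \<bullet> (sym_block P (rowvector a) (mat 1 :: real^1^1) *v (x \<oplus>\<^sub>v vec (- 1)))"
    using assms(1) by (simp add: pos_semidef_def)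
  then show ?thesis
    using assms(2) by (simp add: quadratic_form_sym_block rowvector_mult mat1_mult inner_vec1 ellipsoid_def
       del: vec_neg)
qed

section \<open>Tools for the decrease of a Lyapunov function\<close>

lemma pos_def_lower_bound:
  fixes M :: "real^'n^'n"
  assumes "pos_def M"
  obtains m where "0 < m" "\<And>z. m * (norm z)\<^sup>2 \<le> z \<bullet> (M *v z)"
proof -
  have "continuous_on (sphere 0 1) (\<lambda>z. z \<bullet> (M *v z))"
    by (intro continuous_on_inner continuous_on_id matrix_vector_mult_linear_continuous_on)
  then have "\<exists>z0\<in>sphere 0 1. \<forall>z\<in>sphere 0 1. z0 \<bullet> (M *v z0) \<le> z \<bullet> (M *v z)"
    by (intro continuous_attains_inf) simp_all
  then obtain z0 where z0: "z0 \<in> sphere 0 1" "\<And>z. z \<in> sphere 0 1 \<Longrightarrow> z0 \<bullet> (M *v z0) \<le> z \<bullet> (M *v z)"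
    by blast
  have "(z0 \<bullet> (M *v z0)) * (norm z)\<^sup>2 \<le> z \<bullet> (M *v z)" for z
  proof (cases "z = 0")
    case False
    define e where "e = z /\<^sub>R norm z"
    have z: "z = norm z *\<^sub>R e" using False by (simp add: e_def)
    have "z0 \<bullet> (M *v z0) \<le> e \<bullet> (M *v e)"
      using False by (intro z0(2)) (simp add: e_def)
    then have "(z0 \<bullet> (M *v z0)) * (norm z)\<^sup>2 \<le> (e \<bullet> (M *v e)) * (norm z)\<^sup>2"
      by (rule mult_right_mono) simp
    also have "\<dots> = (norm z *\<^sub>R e) \<bullet> (M *v (norm z *\<^sub>R e))"
      by (simp add: matrix_vector_mult_scaleR power2_eq_square)
    finally show ?thesis by (simp flip: z)
  qed simp
  moreover have "0 < z0 \<bullet> (M *v z0)"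
  proof -
    have "z0 \<noteq> 0" using z0(1) by auto
    then show ?thesis using assms by (simp add: pos_def_def)
  qed
  ultimately show ?thesis by (rule that[rotated])
qed

lemma quadratic_form_upper_bound:
  fixes M :: "real^'n^'n"
  obtains B where "0 < B" "\<And>z. z \<bullet> (M *v z) \<le> B * (norm z)\<^sup>2"
proof -
  obtain B where B: "0 < B" "\<And>z. norm (M *v z) \<le> B * norm z"
    using linear_bounded_pos[OF matrix_vector_mul_linear] by metis
  have "z \<bullet> (M *v z) \<le> B * (norm z)\<^sup>2" for z
  proof -
    have "z \<bullet> (M *v z) \<le> norm z * norm (M *v z)" by (rule norm_cauchy_schwarz)
    also have "\<dots> \<le> norm z * (B * norm z)" by (intro mult_left_mono B) simp
    finally show ?thesis by (simp add: power2_eq_square algebra_simps)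
  qed
  with B(1) show ?thesis by (rule that)
qed

text \<open>A substitute for differentiation: the parameter is only measurable in time, so a Lyapunov function
  need not be differentiable along a trajectory at a given instant, but its one-sided decrease
  can be seen at every instant. The last time at which \<open>u \<le> u a\<close> holds can only be \<open>b\<close>. Local decrease is
  demanded only where \<open>u \<le> u a\<close>, because outside the ellipsoid nothing is known.\<close>

lemma le_of_locally_nonincreasing:
  fixes u :: "real \<Rightarrow> real"
  assumes "a \<le> b" and u: "continuous_on {a..b} u"
    and loc: "\<And>s. s \<in> {a..<b} \<Longrightarrow> u s \<le> u a \<Longrightarrow> \<exists>\<epsilon>>0. \<forall>t\<in>{a..b}. s < t \<and> t < s + \<epsilon> \<longrightarrow> u t \<le> u s"
  shows "u b \<le> u a"
proof (rule ccontr)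
  assume "\<not> u b \<le> u a"
  define S where "S = {s \<in> {a..b}. u s \<le> u a}"
  have "closed S"
    unfolding S_def using u by (intro continuous_on_closed_Collect_le) (auto intro: continuous_intros)
  moreover have S: "a \<in> S" "bdd_above S"
    using \<open>a \<le> b\<close> by (auto simp: S_def bdd_above_def)
  ultimately have Sup: "Sup S \<in> S"
    by (metis closed_contains_Sup empty_iff)
  then have "Sup S \<noteq> b" using \<open>\<not> u b \<le> u a\<close> by (auto simp: S_def)
  then have lt: "Sup S < b" using Sup by (auto simp: S_def)
  then obtain \<epsilon> where \<epsilon>: "\<epsilon> > 0" "\<forall>t\<in>{a..b}. Sup S < t \<and> t < Sup S + \<epsilon> \<longrightarrow> u t \<le> u (Sup S)"
    using loc[of "Sup S"] Sup by (auto simp: S_def)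
  \<comment> \<open>a time beyond \<open>Sup S\<close> that still belongs to \<open>S\<close>\<close>
  define t where "t = min b (Sup S + \<epsilon> / 2)"
  have t: "t \<in> {a..b}" "Sup S < t" "t < Sup S + \<epsilon>"
    using lt \<epsilon>(1) Sup by (auto simp: t_def S_def min_def)
  then have "u t \<le> u (Sup S)" using \<epsilon>(2) by blast
  then have "t \<in> S" using t(1) Sup by (auto simp: S_def)
  then show False using t(2) cSup_upper[OF _ S(2)] by fastforce
qed

text \<open>The tube lemma turns a strict bound at one state into a bound near that state that is uniform in
  the parameters, which may jump arbitrarily.\<close>

lemma strict_bound_near_compact_fibre:
  fixes g :: "'a::metric_space \<times> 'b::metric_space \<Rightarrow> real"
  assumes "compact D" "open U" "continuous_on U g"
    and "\<And>\<delta>. \<delta> \<in> D \<Longrightarrow> (z, \<delta>) \<in> U \<and> g (z, \<delta>) < b"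
  shows "\<exists>e>0. \<forall>y \<delta>. dist y z < e \<longrightarrow> \<delta> \<in> D \<longrightarrow> g (y, \<delta>) < b"
proof -
  have "open (U \<inter> g -` {..<b})"
    using assms(2,3) by (intro continuous_open_preimage) auto
  moreover have "{z} \<times> D \<subseteq> U \<inter> g -` {..<b}"
    using assms(4) by auto
  ultimately have "\<exists>Y. z \<in> Y \<and> open Y \<and> Y \<times> D \<subseteq> U \<inter> g -` {..<b}"
    by (rule Elementary_Topology.tube_lemma[OF assms(1)])
  then obtain Y where Y: "z \<in> Y" "open Y" "Y \<times> D \<subseteq> U \<inter> g -` {..<b}"
    by blast
  then obtain e where "0 < e" "ball z e \<subseteq> Y"
    using open_contains_ball by metis
  have "g (y, \<delta>) < b" if "dist y z < e" "\<delta> \<in> D" for y \<delta>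
  proof -
    have "y \<in> Y" using that(1) \<open>ball z e \<subseteq> Y\<close> by (auto simp: dist_commute)
    then have "(y, \<delta>) \<in> U \<inter> g -` {..<b}" using Y(3) that(2) by blast
    then show ?thesis by simp
  qed
  then show ?thesis using \<open>0 < e\<close> by blast
qed

section \<open>Continuity and measurability of the closed loop\<close>

lemma C1_on_imp_continuous_on: "C1_on \<Omega> F \<Longrightarrow> continuous_on \<Omega> F"
  unfolding C1_on_def by (blast intro: continuous_at_imp_continuous_on has_derivative_continuous)

lemma continuous_on_matrix_vector_mult:
  fixes A :: "'a::topological_space \<Rightarrow> real^'j^'i"
  assumes "continuous_on S A" "continuous_on S v"
  shows "continuous_on S (\<lambda>z. A z *v v z)"
  unfolding matrix_vector_mult_def
  by (intro continuous_on_vec_lambda continuous_on_sum continuous_on_mult continuous_on_component assms)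

lemma continuous_on_sat:
  fixes v :: "'a::topological_space \<Rightarrow> real^'i"
  assumes "\<forall>i. 0 < u $ i" "continuous_on S v"
  shows "continuous_on S (\<lambda>z. sat u (v z))"
proof -
  have "sat u (v z) $ i = max (- u $ i) (min (v z $ i) (u $ i))" for z i
    using assms(1)[rule_format, of i] by (auto simp: sat_nth)
  then have "(\<lambda>z. sat u (v z)) = (\<lambda>z. \<chi> i. max (- u $ i) (min (v z $ i) (u $ i)))"
    by (simp add: fun_eq_iff vec_eq_iff)
  then show ?thesis
    by (simp only:) (intro continuous_on_vec_lambda continuous_on_max continuous_on_min
        continuous_on_const continuous_on_component assms(2))
qed

text \<open>Parameters are Lebesgue measurable in time, so the composition is measurable because the outer
  function is Borel, being continuous on \<open>\<Omega>\<close>.\<close>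

lemma measurable_along_trajectory:
  fixes x :: "real \<Rightarrow> 'a::euclidean_space" and \<delta> :: "real \<Rightarrow> 'b::euclidean_space"
    and G :: "'a \<Rightarrow> 'b \<Rightarrow> 'c::euclidean_space"
  assumes "\<delta> \<in> borel_measurable (lebesgue_on {0..})" "I \<in> sets lebesgue" "I \<subseteq> {0..}"
    and "continuous_on I x" "continuous_on \<Omega> (case_prod G)" "\<And>t. t \<in> I \<Longrightarrow> (x t, \<delta> t) \<in> \<Omega>"
  shows "(\<lambda>t. G (x t) (\<delta> t)) \<in> borel_measurable (lebesgue_on I)"
proof -
  have "\<delta> \<in> borel_measurable (lebesgue_on I)"
    by (rule measurable_restrict_mono[OF assms(1,3)])
  moreover have "x \<in> borel_measurable (lebesgue_on I)"
    by (rule continuous_imp_measurable_on_sets_lebesgue[OF assms(4,2)])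
  ultimately have "(\<lambda>t. (x t, \<delta> t)) \<in> borel_measurable (lebesgue_on I)"
    by (intro borel_measurable_Pair)
  then have "(\<lambda>t. (x t, \<delta> t)) \<in> measurable (lebesgue_on I) (restrict_space borel \<Omega>)"
    by (rule measurable_restrict_space2[rotated]) (use assms(6) in auto)
  from measurable_compose[OF this borel_measurable_continuous_on_restrict[OF assms(5)]]
  show ?thesis by simp
qed

lemma admissible_params_shift:
  fixes \<delta> :: "real \<Rightarrow> real^'l"
  assumes "\<delta> \<in> admissible_params D" "0 \<le> c"
  shows "(\<lambda>t. \<delta> (t + c)) \<in> admissible_params D"
proof -
  have "(\<lambda>t. if t \<in> {0..} then \<delta> t else 0) \<in> borel_measurable lebesgue"
    using assms(1) by (intro borel_measurable_if_I) (auto simp: admissible_params_def)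
  moreover have "(\<lambda>t::real. c + t) \<in> measurable lebesgue lebesgue"
    using lebesgue_affine_measurable[of "\<lambda>_. 1" c] by simp
  ultimately have "(\<lambda>t. if c + t \<in> {0..} then \<delta> (c + t) else 0) \<in> borel_measurable lebesgue"
    by (rule measurable_compose[rotated])
  then have "(\<lambda>t. if c + t \<in> {0..} then \<delta> (c + t) else 0) \<in> borel_measurable (lebesgue_on {0..})"
    by (rule measurable_restrict_space1)
  then have "(\<lambda>t. \<delta> (t + c)) \<in> borel_measurable (lebesgue_on {0..})"
    by (rule measurable_lebesgue_cong[THEN iffD1, rotated]) (use assms(2) in \<open>auto simp: add.commute\<close>)
  then show ?thesis
    using assms by (auto simp: admissible_params_def)
qed

lemma const_admissible_params: "d \<in> D \<Longrightarrow> (\<lambda>t. d) \<in> admissible_params D"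
  by (simp add: admissible_params_def)

section \<open>Systems with a quadratic Lyapunov function\<close>

text \<open>The state equation \<open>x' = F x \<delta>\<close> with parameters in \<open>D\<close>, for which $x^T P x$ decreases at rate
  $x^T N x$, as far as known only inside the unit ellipsoid.\<close>

locale dissipative_system =
  fixes \<Omega> :: "((real^'n) \<times> (real^'l)) set" and F :: "real^'n \<Rightarrow> real^'l \<Rightarrow> real^'n"
    and D :: "(real^'l) set" and P N :: "real^'n^'n"
  assumes open_domain: "open \<Omega>" and field_continuous: "continuous_on \<Omega> (case_prod F)"
    and compact_params: "compact D" and ellipsoid_domain: "ellipsoid P 1 \<times> D \<subseteq> \<Omega>"
    and P: "pos_def P" and N: "pos_def N"
    and dissipation: "\<And>x \<delta>. x \<in> ellipsoid P 1 \<Longrightarrow> \<delta> \<in> D \<Longrightarrow> 2 * (x \<bullet> (P *v F x \<delta>)) \<le> - (x \<bullet> (N *v x))"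
begin

definition lyap :: "real^'n \<Rightarrow> real" where
  "lyap x = x \<bullet> (P *v x)"

definition solution :: "(real \<Rightarrow> real^'l) \<Rightarrow> real set \<Rightarrow> (real \<Rightarrow> real^'n) \<Rightarrow> bool" where
  "solution \<delta> I x \<longleftrightarrow> (\<forall>t\<in>I. (x t, \<delta> t) \<in> \<Omega> \<and>
     (\<lambda>s. F (x s) (\<delta> s)) absolutely_integrable_on {0..t} \<and>
     x t = x 0 + integral {0..t} (\<lambda>s. F (x s) (\<delta> s)))"

lemma ellipsoid_iff: "x \<in> ellipsoid P 1 \<longleftrightarrow> lyap x \<le> 1"
  by (simp add: ellipsoid_def lyap_def)

lemma lyap_continuous: "continuous_on S lyap"
  unfolding lyap_def
  by (intro continuous_on_inner continuous_on_id matrix_vector_mult_linear_continuous_on)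

lemma P_sym: "u \<bullet> (P *v v) = v \<bullet> (P *v u)"
  using P by (intro inner_sym_mult) (simp add: pos_def_def)

lemma lyap_nonneg: "0 \<le> lyap x"
  using P by (cases "x = 0") (auto simp: pos_def_def lyap_def less_imp_le)

lemma compact_ellipsoid: "compact (ellipsoid P 1)"
proof -
  obtain m where m: "0 < m" "\<And>z. m * (norm z)\<^sup>2 \<le> z \<bullet> (P *v z)"
    using pos_def_lower_bound[OF P] by blast
  have "closed (lyap -` {..1})"
    by (intro closed_vimage closed_atMost) (rule lyap_continuous)
  moreover have "ellipsoid P 1 = lyap -` {..1}"
    by (auto simp: ellipsoid_iff)
  moreover have "norm z \<le> sqrt (1 / m)" if "z \<in> ellipsoid P 1" for z
  proof (rule real_le_rsqrt)
    show "(norm z)\<^sup>2 \<le> 1 / m"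
      using m(1) order_trans[OF m(2)[of z]] that by (auto simp: ellipsoid_def field_simps)
  qed
  ultimately show ?thesis
    by (auto simp: compact_eq_bounded_closed bounded_iff)
qed

lemma field_bounded:
  obtains B where "\<And>x \<delta>. x \<in> ellipsoid P 1 \<Longrightarrow> \<delta> \<in> D \<Longrightarrow> norm (F x \<delta>) \<le> B"
proof -
  have "compact (case_prod F ` (ellipsoid P 1 \<times> D))"
    by (intro compact_continuous_image continuous_on_subset[OF field_continuous]
        compact_Times compact_ellipsoid compact_params ellipsoid_domain)
  then obtain B where "\<forall>y \<in> case_prod F ` (ellipsoid P 1 \<times> D). norm y \<le> B"
    using compact_imp_bounded bounded_iff by blast
  then show ?thesis using that by force
qed

subsection \<open>Decay along trajectories\<close>

text \<open>The form of the bound is dictated by the identity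
  $V(x(s)) - V(x(t)) = (x(s) - x(t))^T P (x(s) + x(t))$ for $V(x) = x^T P x$: with the increment written as
  an integral of \<open>F\<close>, the integrand is \<open>F y \<delta> \<bullet> (P *v (z + z0))\<close> with \<open>y\<close> an intermediate state and
  \<open>z\<close> the final one. At \<open>y = z = z0\<close> it is at most $-z_0^T N z_0$; half of that rate
  survives nearby.\<close>

lemma locally_uniform_decay:
  assumes "z0 \<in> ellipsoid P 1" "z0 \<noteq> 0"
  obtains d where "0 < d"
    "\<And>y z \<delta>. dist y z0 < d \<Longrightarrow> dist z z0 < d \<Longrightarrow> \<delta> \<in> D \<Longrightarrow>
       F y \<delta> \<bullet> (P *v (z + z0)) \<le> - (z0 \<bullet> (N *v z0)) / 2"
proof -
  define g :: "((real^'n) \<times> (real^'n)) \<times> (real^'l) \<Rightarrow> real"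
    where "g p = case_prod F (fst (fst p), snd p) \<bullet> (P *v (snd (fst p) + z0))" for p
  define U where "U = (\<lambda>p :: ((real^'n) \<times> (real^'n)) \<times> (real^'l). (fst (fst p), snd p)) -` \<Omega>"
  define b where "b = - (z0 \<bullet> (N *v z0)) / 2"
  have "open U"
    unfolding U_def
    by (intro open_vimage[OF open_domain] continuous_on_Pair continuous_on_fst continuous_on_snd
        continuous_on_id)
  moreover have "continuous_on U g"
  proof -
    have "continuous_on U (\<lambda>p. (fst (fst p), snd p))"
      by (intro continuous_on_Pair continuous_on_fst continuous_on_snd continuous_on_id)
    then have "continuous_on U (\<lambda>p. case_prod F (fst (fst p), snd p))"
      by (rule continuous_on_compose2[OF field_continuous]) (simp add: U_def)
    moreover have "continuous_on U (\<lambda>p. snd (fst p) + z0)"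
      by (intro continuous_on_add continuous_on_const continuous_on_fst continuous_on_snd
          continuous_on_id)
    then have "continuous_on U (\<lambda>p. P *v (snd (fst p) + z0))"
      by (rule continuous_on_compose2[OF matrix_vector_mult_linear_continuous_on[of UNIV]]) simp
    ultimately show ?thesis
      unfolding g_def by (rule continuous_on_inner)
  qed
  moreover have "((z0, z0), \<delta>) \<in> U \<and> g ((z0, z0), \<delta>) < b" if "\<delta> \<in> D" for \<delta>
  proof -
    have "F z0 \<delta> \<bullet> (P *v (z0 + z0)) = 2 * (z0 \<bullet> (P *v F z0 \<delta>))"
      using P_sym[of z0 "F z0 \<delta>"] unfolding matrix_vector_right_distrib inner_add_right by linarith
    also have "\<dots> \<le> - (z0 \<bullet> (N *v z0))" by (rule dissipation[OF assms(1) that])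
    also have "\<dots> < b" using N assms(2) by (auto simp: pos_def_def b_def)
    finally show ?thesis using ellipsoid_domain assms(1) that by (auto simp: U_def g_def)
  qed
  ultimately obtain e where e: "0 < e" "\<And>y \<delta>. dist y (z0, z0) < e \<Longrightarrow> \<delta> \<in> D \<Longrightarrow> g (y, \<delta>) < b"
    using strict_bound_near_compact_fibre[OF compact_params, of U g "(z0, z0)" b] by blast
  show ?thesis
  proof (rule that[of "e / 2"])
    fix y z \<delta> assume "dist y z0 < e / 2" "dist z z0 < e / 2" "\<delta> \<in> D"
    then have "dist (y, z) (z0, z0) < e"
      using sqrt_sum_squares_le_sum_abs[of "dist y z0" "dist z z0"] by (simp add: dist_Pair_Pair)
    from e(2)[OF this \<open>\<delta> \<in> D\<close>] show "F y \<delta> \<bullet> (P *v (z + z0)) \<le> - (z0 \<bullet> (N *v z0)) / 2"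
      by (simp add: g_def b_def)
  qed (use e in simp)
qed

text \<open>In what follows \<open>I\<close> stands for a time interval that starts at \<open>0\<close>.\<close>

context
  fixes \<delta> :: "real \<Rightarrow> real^'l" and I :: "real set" and x :: "real \<Rightarrow> real^'n"
  assumes \<delta>: "\<delta> \<in> admissible_params D" and x: "solution \<delta> I x"
    and I: "I \<subseteq> {0..}" "\<And>t. t \<in> I \<Longrightarrow> {0..t} \<subseteq> I"
begin

lemma solution_continuous: "t \<in> I \<Longrightarrow> continuous_on {0..t} x"
proof -
  assume t: "t \<in> I"
  have "continuous_on {0..t} (\<lambda>s. x 0 + integral {0..s} (\<lambda>s. F (x s) (\<delta> s)))"
    using x t unfolding solution_def
    by (intro continuous_intros indefinite_integral_continuous_1 set_lebesgue_integral_eq_integral) auto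
  then show ?thesis
    using x I(2)[OF t] unfolding solution_def by (subst continuous_on_cong[OF refl]) auto
qed

lemma solution_continuous_on: "continuous_on I x"
  unfolding continuous_on_iff
proof (intro ballI allI impI)
  fix t and e :: real assume t: "t \<in> I" "0 < e"
  show "\<exists>d>0. \<forall>s\<in>I. dist s t < d \<longrightarrow> dist (x s) (x t) < e"
  proof (cases "\<exists>b\<in>I. t < b")
    case True
    then obtain b where b: "b \<in> I" "t < b" by blast
    have "t \<in> {0..b}" using t(1) I(1) b(2) by auto
    then obtain d where d: "0 < d" "\<And>s. s \<in> {0..b} \<Longrightarrow> dist s t < d \<Longrightarrow> dist (x s) (x t) < e"
      using solution_continuous[OF b(1)] t(2) unfolding continuous_on_iff by meson
    have "dist (x s) (x t) < e" if "s \<in> I" "dist s t < min d (b - t)" for s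
      using that I(1) by (intro d(2)) (auto simp: dist_real_def)
    then show ?thesis using d(1) b(2) by (intro exI[of _ "min d (b - t)"]) auto
  next
    case False
    then have "I \<subseteq> {0..t}" using I(1) by force
    then have "continuous_on I x"
      by (rule continuous_on_subset[OF solution_continuous[OF t(1)]])
    then show ?thesis using t unfolding continuous_on_iff by meson
  qed
qed

lemma lyap_solution_continuous: "t \<in> I \<Longrightarrow> continuous_on {0..t} (\<lambda>\<tau>. lyap (x \<tau>))"
  by (rule continuous_on_compose2[OF lyap_continuous[of UNIV] solution_continuous]) auto

lemma solution_increment:
  assumes "s \<in> I" "t \<in> I" "s \<le> t"
  shows "((\<lambda>\<tau>. F (x \<tau>) (\<delta> \<tau>)) has_integral (x t - x s)) {s..t}"
proof -
  let ?\<phi> = "\<lambda>\<tau>. F (x \<tau>) (\<delta> \<tau>)"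
  have int: "?\<phi> integrable_on {0..t}"
    using x assms(2) unfolding solution_def by (auto intro: set_lebesgue_integral_eq_integral)
  have "0 \<le> s" using I(1) assms(1) by auto
  then have "integral {0..s} ?\<phi> + integral {s..t} ?\<phi> = integral {0..t} ?\<phi>"
    using assms(3) int by (intro Henstock_Kurzweil_Integration.integral_combine) auto
  moreover have "x s = x 0 + integral {0..s} ?\<phi>" "x t = x 0 + integral {0..t} ?\<phi>"
    using x assms(1,2) unfolding solution_def by blast+
  moreover have "?\<phi> integrable_on {s..t}"
    using int by (rule integrable_on_subinterval) (use \<open>0 \<le> s\<close> in auto)
  ultimately show ?thesis
    by (simp add: has_integral_integrable_integral algebra_simps)
qed

text \<open>By the identity above, the increment of the Lyapunov function is a single integral of the velocity
  against a fixed vector, and the integrand is bounded as long as the trajectory is near \<open>x t\<close>.\<close>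

lemma lyap_local_decay:
  assumes t: "t \<in> I" "x t \<in> ellipsoid P 1" "x t \<noteq> 0"
  obtains \<epsilon> where "0 < \<epsilon>"
    "\<And>s. s \<in> I \<Longrightarrow> t < s \<Longrightarrow> s < t + \<epsilon> \<Longrightarrow> lyap (x s) \<le> lyap (x t) - (x t \<bullet> (N *v x t)) / 2 * (s - t)"
proof (cases "\<exists>b\<in>I. t < b")
  case True
  then obtain b where b: "b \<in> I" "t < b" by blast
  obtain d where d: "0 < d" "\<And>y z \<delta>. dist y (x t) < d \<Longrightarrow> dist z (x t) < d \<Longrightarrow> \<delta> \<in> D \<Longrightarrow>
       F y \<delta> \<bullet> (P *v (z + x t)) \<le> - (x t \<bullet> (N *v x t)) / 2"
    using locally_uniform_decay[OF t(2,3)] by blast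
  have "0 \<le> t" using t(1) I(1) by auto
  then obtain e where e: "0 < e" "\<And>s. s \<in> {0..b} \<Longrightarrow> dist s t < e \<Longrightarrow> dist (x s) (x t) < d"
    using solution_continuous[OF b(1)] d(1) b(2) unfolding continuous_on_iff by force
  show ?thesis
  proof (rule that[of "min e (b - t)"])
    fix s assume s: "s \<in> I" "t < s" "s < t + min e (b - t)"
    then have near: "dist (x \<tau>) (x t) < d" if "\<tau> \<in> {t..s}" for \<tau>
      using that \<open>0 \<le> t\<close> by (intro e(2)) (auto simp: dist_real_def)
    have "lyap (x s) - lyap (x t) = (x s - x t) \<bullet> (P *v (x s + x t))"
      using P_sym[of "x t" "x s"]
      by (simp add: lyap_def inner_diff_left inner_add_right matrix_vector_right_distrib)
    also have "\<dots> \<le> integral {t..s} (\<lambda>\<tau>. - (x t \<bullet> (N *v x t)) / 2)"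
    proof (rule has_integral_le)
      show "((\<lambda>\<tau>. F (x \<tau>) (\<delta> \<tau>) \<bullet> (P *v (x s + x t))) has_integral
              (x s - x t) \<bullet> (P *v (x s + x t))) {t..s}"
        using has_integral_linear[OF solution_increment[OF t(1) s(1)]
            bounded_linear_inner_left[of "P *v (x s + x t)"]] s(2) by (simp add: o_def)
      show "F (x \<tau>) (\<delta> \<tau>) \<bullet> (P *v (x s + x t)) \<le> - (x t \<bullet> (N *v x t)) / 2" if "\<tau> \<in> {t..s}" for \<tau>
        using near[OF that] near[of s] s(2) that \<delta> \<open>0 \<le> t\<close>
        by (intro d(2)) (auto simp: admissible_params_def)
    qed (intro integrable_integral integrable_const_ivl)
    also have "\<dots> = - ((x t \<bullet> (N *v x t)) / 2 * (s - t))"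
      using s(2) by simp
    finally show "lyap (x s) \<le> lyap (x t) - (x t \<bullet> (N *v x t)) / 2 * (s - t)" by simp
  qed (use e b in simp)
next
  case False
  then show ?thesis using that[of 1] by force
qed

text \<open>Truncating at a positive level \<open>c\<close> hides the neighbourhood of the origin, where the decay rate
  is not bounded away from zero. Since \<open>c \<le> 1\<close>, the sublevel set lies in the ellipsoid.\<close>

lemma lyap_below_level:
  assumes "s \<in> I" "t \<in> I" "s \<le> t" "0 < c" "c \<le> 1" "lyap (x s) \<le> c"
  shows "lyap (x t) \<le> c"
proof -
  let ?u = "\<lambda>\<tau>. max (lyap (x \<tau>)) c"
  have cont: "continuous_on {s..t} (\<lambda>\<tau>. lyap (x \<tau>))"
    by (rule continuous_on_subset[OF lyap_solution_continuous[OF assms(2)]]) (use I(1) assms(1) in auto)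
  have "?u t \<le> ?u s"
  proof (rule le_of_locally_nonincreasing[OF assms(3)])
    show "continuous_on {s..t} ?u"
      using cont by (intro continuous_intros)
    fix r assume r: "r \<in> {s..<t}" "?u r \<le> ?u s"
    have sub: "{s..t} \<subseteq> I"
      using I(1) I(2)[OF assms(2)] assms(1) by fastforce
    then have r': "r \<in> I" "x r \<in> ellipsoid P 1"
      using r assms by (auto simp: ellipsoid_iff max_def split: if_splits)
    show "\<exists>\<epsilon>>0. \<forall>\<tau>\<in>{s..t}. r < \<tau> \<and> \<tau> < r + \<epsilon> \<longrightarrow> ?u \<tau> \<le> ?u r"
    proof (cases "x r = 0")
      case True
      then have "lyap (x r) = 0" by (simp add: lyap_def)
      moreover have "r \<in> {s..t}" using r(1) by simp
      ultimately obtain \<epsilon> where \<epsilon>: "\<epsilon> > 0" "\<forall>\<tau>\<in>{s..t}. dist \<tau> r < \<epsilon> \<longrightarrow> dist (lyap (x \<tau>)) 0 < c"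
        using cont \<open>0 < c\<close> unfolding continuous_on_iff by metis
      have "?u \<tau> \<le> ?u r" if "\<tau> \<in> {s..t}" "r < \<tau>" "\<tau> < r + \<epsilon>" for \<tau>
      proof -
        have "dist (lyap (x \<tau>)) 0 < c" using \<epsilon>(2) that by (simp add: dist_real_def)
        then have "lyap (x \<tau>) \<le> c" by (simp add: dist_real_def)
        then show ?thesis by simp
      qed
      then show ?thesis using \<epsilon>(1) by blast
    next
      case False
      then obtain \<epsilon> where \<epsilon>: "0 < \<epsilon>"
        "\<And>s. s \<in> I \<Longrightarrow> r < s \<Longrightarrow> s < r + \<epsilon> \<Longrightarrow> lyap (x s) \<le> lyap (x r) - (x r \<bullet> (N *v x r)) / 2 * (s - r)"
        using lyap_local_decay[OF r'] by blast
      have "0 < x r \<bullet> (N *v x r)" using N False by (auto simp: pos_def_def)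
      then have "0 \<le> (x r \<bullet> (N *v x r)) / 2 * (\<tau> - r)" if "r < \<tau>" for \<tau>
        using that by simp
      then have "lyap (x \<tau>) \<le> lyap (x r)" if "\<tau> \<in> I" "r < \<tau>" "\<tau> < r + \<epsilon>" for \<tau>
        using \<epsilon>(2)[OF that] that(2) by fastforce
      then have "?u \<tau> \<le> ?u r" if "\<tau> \<in> {s..t}" "r < \<tau>" "\<tau> < r + \<epsilon>" for \<tau>
        using that sub by (intro max.mono) auto
      then show ?thesis using \<epsilon>(1) by blast
    qed
  qed
  then show ?thesis using assms by simp
qed

lemma lyap_nonincreasing:
  assumes "s \<in> I" "t \<in> I" "s \<le> t" "x s \<in> ellipsoid P 1"
  shows "lyap (x t) \<le> lyap (x s)"
proof (cases "lyap (x s) = 0")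
  case True
  then have "lyap (x t) \<le> c" if "0 < c" for c
    using lyap_below_level[OF assms(1-3), of "min c 1"] that by simp
  then show ?thesis
    using True by (metis field_le_epsilon add_0)
next
  case False
  then show ?thesis
    using lyap_below_level[OF assms(1-3), of "lyap (x s)"] assms(4) lyap_nonneg[of "x s"]
    by (simp add: ellipsoid_iff)
qed

lemma ellipsoid_invariant: "t \<in> I \<Longrightarrow> x 0 \<in> ellipsoid P 1 \<Longrightarrow> x t \<in> ellipsoid P 1"
  using lyap_below_level[of 0 t 1] I by (fastforce simp: ellipsoid_iff)

text \<open>Since the Lyapunov function never increases, it is at least \<open>c\<close> up to time \<open>T\<close>. It therefore
  decreases at rate at least \<open>k c / 2\<close>, starting from a value of at most \<open>1\<close>.\<close>

lemma lyap_decay_time: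
  assumes k: "\<And>z. k * lyap z \<le> z \<bullet> (N *v z)" and "0 < k"
    and T: "T \<in> I" "x 0 \<in> ellipsoid P 1" "0 < c" "c \<le> lyap (x T)"
  shows "k * c / 2 * T \<le> 1"
proof -
  let ?u = "\<lambda>\<tau>. lyap (x \<tau>) + k * c / 2 * \<tau>"
  have "0 \<le> T" using T(1) I by auto
  have "?u T \<le> ?u 0"
  proof (rule le_of_locally_nonincreasing[OF \<open>0 \<le> T\<close>])
    show "continuous_on {0..T} ?u"
      by (intro continuous_intros lyap_solution_continuous[OF T(1)])
    fix s assume s: "s \<in> {0..<T}"
    then have s': "s \<in> I" using I(2)[OF T(1)] by auto
    have E: "x s \<in> ellipsoid P 1" by (rule ellipsoid_invariant[OF s' T(2)])
    have c: "c \<le> lyap (x s)"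
      using lyap_nonincreasing[OF s' T(1) _ E] s T(4) by simp
    then have "x s \<noteq> 0" using T(3) by (auto simp: lyap_def)
    then obtain \<epsilon> where \<epsilon>: "0 < \<epsilon>"
      "\<And>t. t \<in> I \<Longrightarrow> s < t \<Longrightarrow> t < s + \<epsilon> \<Longrightarrow> lyap (x t) \<le> lyap (x s) - (x s \<bullet> (N *v x s)) / 2 * (t - s)"
      using lyap_local_decay[OF s' E] by blast
    have "k * c \<le> x s \<bullet> (N *v x s)"
      using k[of "x s"] mult_left_mono[OF c, of k] \<open>0 < k\<close> by linarith
    then have "?u t \<le> ?u s" if "t \<in> I" "s < t" "t < s + \<epsilon>" for t
    proof -
      have "k * c / 2 * (t - s) \<le> (x s \<bullet> (N *v x s)) / 2 * (t - s)"
        using \<open>k * c \<le> x s \<bullet> (N *v x s)\<close> that(2) by (intro mult_right_mono) auto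
      moreover have "k * c / 2 * t = k * c / 2 * s + k * c / 2 * (t - s)"
        by (simp add: right_diff_distrib)
      ultimately show ?thesis using \<epsilon>(2)[OF that] by linarith
    qed
    then show "\<exists>\<epsilon>>0. \<forall>t\<in>{0..T}. s < t \<and> t < s + \<epsilon> \<longrightarrow> ?u t \<le> ?u s"
      using \<epsilon>(1) I(2)[OF T(1)] by blast
  qed
  moreover have "lyap (x 0) \<le> 1" "0 \<le> lyap (x T)"
    using T(2) lyap_nonneg by (auto simp: ellipsoid_iff)
  ultimately show ?thesis by simp
qed

end

lemma lyap_rate:
  obtains k where "0 < k" "\<And>z. k * lyap z \<le> z \<bullet> (N *v z)"
proof -
  obtain m where m: "0 < m" "\<And>z. m * (norm z)\<^sup>2 \<le> z \<bullet> (N *v z)"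
    using pos_def_lower_bound[OF N] by blast
  obtain B where B: "0 < B" "\<And>z. z \<bullet> (P *v z) \<le> B * (norm z)\<^sup>2"
    using quadratic_form_upper_bound by blast
  have "m / B * lyap z \<le> z \<bullet> (N *v z)" for z
  proof -
    have "m / B * lyap z \<le> m / B * (B * (norm z)\<^sup>2)"
      using m(1) B unfolding lyap_def by (intro mult_left_mono) auto
    then show ?thesis using m(2)[of z] B(1) by simp
  qed
  then show ?thesis using that[of "m / B"] m(1) B(1) by simp
qed

lemma solution_tendsto_zero:
  assumes "\<delta> \<in> admissible_params D" "solution \<delta> {0..} x" "x 0 \<in> ellipsoid P 1"
  shows "(x \<longlongrightarrow> 0) at_top"
proof -
  obtain k where k: "0 < k" "\<And>z. k * lyap z \<le> z \<bullet> (N *v z)"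
    using lyap_rate by blast
  obtain m where m: "0 < m" "\<And>z. m * (norm z)\<^sup>2 \<le> z \<bullet> (P *v z)"
    using pos_def_lower_bound[OF P] by blast
  show ?thesis
  proof (rule tendstoI)
    fix e :: real assume "0 < e"
    define c where "c = m * e\<^sup>2"
    have "0 < c" using m(1) \<open>0 < e\<close> by (simp add: c_def)
    have "dist (x t) 0 < e" if "2 / (k * c) < t" for t
    proof -
      have "0 < 2 / (k * c)" using k(1) \<open>0 < c\<close> by simp
      then have "0 \<le> t" using that by linarith
      have "lyap (x t) < c"
      proof (rule ccontr)
        assume "\<not> lyap (x t) < c"
        then have "k * c / 2 * t \<le> 1"
          using \<open>0 \<le> t\<close> \<open>0 < c\<close> by (intro lyap_decay_time[OF assms(1,2) _ _ k(2,1) _ assms(3)]) auto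
        moreover have "1 < k * c / 2 * t"
          using that k(1) \<open>0 < c\<close> by (simp add: pos_divide_less_eq mult.commute)
        ultimately show False by simp
      qed
      then have "m * (norm (x t))\<^sup>2 < m * e\<^sup>2"
        using m(2)[of "x t"] by (simp add: lyap_def c_def)
      then show ?thesis
        using m(1) \<open>0 < e\<close> power2_less_imp_less[of "norm (x t)" e] by simp
    qed
    then show "\<forall>\<^sub>F t in at_top. dist (x t) 0 < e"
      by (rule eventually_mono[OF eventually_gt_at_top[of "2 / (k * c)"]])
  qed
qed

lemma uniformly_stable:
  assumes "0 < e"
  obtains r where "0 < r" "\<And>\<delta> x t. \<delta> \<in> admissible_params D \<Longrightarrow> solution \<delta> {0..} x \<Longrightarrow>
    norm (x 0) < r \<Longrightarrow> 0 \<le> t \<Longrightarrow> norm (x t) < e"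
proof -
  obtain B where B: "0 < B" "\<And>z. z \<bullet> (P *v z) \<le> B * (norm z)\<^sup>2"
    using quadratic_form_upper_bound by blast
  obtain m where m: "0 < m" "\<And>z. m * (norm z)\<^sup>2 \<le> z \<bullet> (P *v z)"
    using pos_def_lower_bound[OF P] by blast
  \<comment> \<open>a sublevel set inside both the unit ellipsoid and the ball of radius \<open>e\<close>\<close>
  define c where "c = min 1 (m * e\<^sup>2)"
  have c: "0 < c" using m(1) assms by (simp add: c_def)
  show ?thesis
  proof (rule that[of "sqrt (c / B)"])
    fix \<delta> x and t :: real
    assume x: "\<delta> \<in> admissible_params D" "solution \<delta> {0..} x" "norm (x 0) < sqrt (c / B)" "0 \<le> t"
    have "(norm (x 0))\<^sup>2 < c / B"
      using power_strict_mono[OF x(3), of 2] c B(1) by simp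
    then have "lyap (x 0) < c"
      using B(1) order_le_less_trans[OF B(2)] by (simp add: lyap_def field_simps)
    moreover from this have "lyap (x t) \<le> lyap (x 0)"
      using x(4) by (intro lyap_nonincreasing[OF x(1,2)]) (auto simp: ellipsoid_iff c_def)
    ultimately have "m * (norm (x t))\<^sup>2 < m * e\<^sup>2"
      using m(2)[of "x t"] by (simp add: lyap_def c_def)
    then show "norm (x t) < e"
      using m(1) assms power2_less_imp_less[of "norm (x t)" e] by simp
  qed (use c B in simp)
qed

lemma ball_in_ellipsoid: obtains r where "0 < r" "ball 0 r \<subseteq> ellipsoid P 1"
proof -
  have "open (lyap -` {..<1})"
    by (intro open_vimage open_lessThan lyap_continuous)
  moreover have "0 \<in> lyap -` {..<1}" by (simp add: lyap_def)
  ultimately obtain r where "0 < r" "ball 0 r \<subseteq> lyap -` {..<1}"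
    using open_contains_ball by blast
  then show ?thesis using that[of r] by (force simp: ellipsoid_iff)
qed

subsection \<open>Global existence\<close>

lemma solution_mono: "solution \<delta> I x \<Longrightarrow> I' \<subseteq> I \<Longrightarrow> solution \<delta> I' x"
  unfolding solution_def by blast

text \<open>Being a solution is a condition on each initial segment separately, which is what makes it
  possible to glue solutions.\<close>

lemma solution_cong:
  assumes "\<And>t. t \<in> I \<Longrightarrow> \<exists>y. solution \<delta> {t} y \<and> (\<forall>s\<in>{0..t}. x s = y s)" "I \<subseteq> {0..}"
  shows "solution \<delta> I x"
  unfolding solution_def
proof
  fix t assume t: "t \<in> I"
  then obtain y where y: "solution \<delta> {t} y" "\<And>s. s \<in> {0..t} \<Longrightarrow> x s = y s"
    using assms(1) by blast
  let ?\<phi> = "\<lambda>x s. F (x s) (\<delta> s)"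
  have eq: "x 0 = y 0" "x t = y t" using y(2) t assms(2) by auto
  have abs: "?\<phi> y absolutely_integrable_on {0..t} \<longleftrightarrow> ?\<phi> x absolutely_integrable_on {0..t}"
    using y(2) by (intro set_integrable_cong) auto
  have int: "integral {0..t} (?\<phi> y) = integral {0..t} (?\<phi> x)"
    using y(2) by (intro Henstock_Kurzweil_Integration.integral_cong) auto
  have "(y t, \<delta> t) \<in> \<Omega> \<and> ?\<phi> y absolutely_integrable_on {0..t} \<and> y t = y 0 + integral {0..t} (?\<phi> y)"
    using y(1) unfolding solution_def by blast
  then show "(x t, \<delta> t) \<in> \<Omega> \<and> ?\<phi> x absolutely_integrable_on {0..t}
      \<and> x t = x 0 + integral {0..t} (?\<phi> x)"
    unfolding eq abs int .
qed

lemma interval_initial: "{0..<T::real} \<subseteq> {0..}" "t \<in> {0..<T::real} \<Longrightarrow> {0..t} \<subseteq> {0..<T}"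
  by auto

text \<open>A trajectory that starts in the ellipsoid stays there, where \<open>F\<close> is bounded. Hence the velocity
  is integrable up to the end \<open>T\<close> of the time interval, and the trajectory has a limit.\<close>

lemma solution_endpoint:
  assumes \<delta>: "\<delta> \<in> admissible_params D" and x: "solution \<delta> {0..<T} x" "x 0 \<in> ellipsoid P 1"
    and "0 < T"
  obtains xT where "xT \<in> ellipsoid P 1"
    "((\<lambda>s. F (x s) (\<delta> s)) has_integral (xT - x 0)) {0..T}"
proof -
  let ?\<phi> = "\<lambda>s. F (x s) (\<delta> s)"
  obtain B where B: "\<And>x \<delta>. x \<in> ellipsoid P 1 \<Longrightarrow> \<delta> \<in> D \<Longrightarrow> norm (F x \<delta>) \<le> B"
    using field_bounded by blast
  have E: "x t \<in> ellipsoid P 1" if "t \<in> {0..<T}" for t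
    by (rule ellipsoid_invariant[OF \<delta> x(1) interval_initial that x(2)])
  have "?\<phi> absolutely_integrable_on {0..<T}"
  proof (rule measurable_bounded_by_integrable_imp_absolutely_integrable)
    show "?\<phi> \<in> borel_measurable (lebesgue_on {0..<T})"
    proof (rule measurable_along_trajectory[OF _ _ _ _ field_continuous])
      show "continuous_on {0..<T} x"
        by (rule solution_continuous_on[OF \<delta> x(1) interval_initial])
      show "(x t, \<delta> t) \<in> \<Omega>" if "t \<in> {0..<T}" for t
        using x(1) that unfolding solution_def by blast
    qed (use \<delta> in \<open>auto simp: admissible_params_def\<close>)
    show "norm (?\<phi> t) \<le> B" if "t \<in> {0..<T}" for t
      using B[OF E[OF that]] \<delta> that by (auto simp: admissible_params_def)
    have "(\<lambda>t. B) integrable_on insert T {0..<T}"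
      using \<open>0 < T\<close> integrable_const_ivl[of B 0 T] by (simp add: atLeastLessThan_eq_atLeastAtMost_diff insert_absorb)
    then show "(\<lambda>t. B) integrable_on {0..<T}"
      by (simp only: integrable_on_insert_iff)
  qed simp
  then have "?\<phi> integrable_on insert T {0..<T}"
    by (simp only: integrable_on_insert_iff set_lebesgue_integral_eq_integral)
  then have int: "?\<phi> integrable_on {0..T}"
    using \<open>0 < T\<close> by (simp add: atLeastLessThan_eq_atLeastAtMost_diff insert_absorb)
  let ?J = "\<lambda>t. x 0 + integral {0..t} ?\<phi>"
  have "continuous_on {0..T} ?J"
    by (intro continuous_on_add continuous_on_const indefinite_integral_continuous_1 int)
  then have "continuous_on (closure {0..<T}) ?J"
    using \<open>0 < T\<close> by simp
  moreover have "?J t = x t" if "t \<in> {0..<T}" for t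
    using x(1) that unfolding solution_def by metis
  then have "?J ` {0..<T} \<subseteq> ellipsoid P 1"
    using E by auto
  ultimately have "?J ` closure {0..<T} \<subseteq> ellipsoid P 1"
    by (intro image_closure_subset compact_imp_closed[OF compact_ellipsoid])
  then have "?J T \<in> ellipsoid P 1" using \<open>0 < T\<close> by auto
  moreover have "(?\<phi> has_integral (?J T - x 0)) {0..T}"
    using int by (simp add: has_integral_integral)
  ultimately show ?thesis by (rule that)
qed

text \<open>A solution on \<open>{0..<T}\<close> is continued by a solution that starts from its limit, under the shifted
  parameter. The junction hypothesis says that \<open>z 0\<close> is that limit.\<close>

lemma solution_concat:
  assumes \<delta>: "\<delta> \<in> admissible_params D" and x: "solution \<delta> {0..<T} x" "x 0 \<in> ellipsoid P 1" "0 < T"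
    and z: "solution (\<lambda>t. \<delta> (t + T)) {0..<\<tau>} z" "z 0 \<in> ellipsoid P 1"
    and join: "((\<lambda>s. F (x s) (\<delta> s)) has_integral (z 0 - x 0)) {0..T}"
  shows "solution \<delta> {0..<T + \<tau>} (\<lambda>t. if t < T then x t else z (t - T))"
    (is "solution _ _ ?y")
  unfolding solution_def
proof
  fix t assume t: "t \<in> {0..<T + \<tau>}"
  let ?\<phi> = "\<lambda>s. F (?y s) (\<delta> s)"
  have \<delta>': "(\<lambda>t. \<delta> (t + T)) \<in> admissible_params D"
    using \<delta> x(3) by (simp add: admissible_params_shift)
  obtain B where B: "\<And>x \<delta>. x \<in> ellipsoid P 1 \<Longrightarrow> \<delta> \<in> D \<Longrightarrow> norm (F x \<delta>) \<le> B"
    using field_bounded by blast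
  have E: "?y s \<in> ellipsoid P 1" if "s \<in> {0..t}" for s
  proof (cases "s < T")
    case True
    then show ?thesis
      using ellipsoid_invariant[OF \<delta> x(1) interval_initial _ x(2), of s] that by simp
  next
    case False
    then show ?thesis
      using ellipsoid_invariant[OF \<delta>' z(1) interval_initial _ z(2), of "s - T"] that t by simp
  qed
  have D: "\<delta> s \<in> D" if "s \<in> {0..t}" for s
    using \<delta> that by (simp add: admissible_params_def)
  have int: "(?\<phi> has_integral (?y t - x 0)) {0..t}"
  proof (cases "t < T")
    case True
    have "((\<lambda>s. F (x s) (\<delta> s)) has_integral (x t - x 0)) {0..t}"
      using True t by (intro solution_increment[OF \<delta> x(1) interval_initial]) auto
    then show ?thesis
      using True by (subst has_integral_cong[where g = "\<lambda>s. F (x s) (\<delta> s)"]) auto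
  next
    case False
    have 1: "(?\<phi> has_integral (z 0 - x 0)) {0..T}"
      by (rule has_integral_spike[OF _ _ join, of "{T}"]) auto
    have "((\<lambda>s. F (z s) (\<delta> (s + T))) has_integral (z (t - T) - z 0)) {0..t - T}"
      using False t by (intro solution_increment[OF \<delta>' z(1) interval_initial]) auto
    from has_integral_shift_real_ivl[OF this, of "- T"]
    have "((\<lambda>s. F (z (s - T)) (\<delta> s)) has_integral (z (t - T) - z 0)) {T..t}"
      by simp
    then have 2: "(?\<phi> has_integral (z (t - T) - z 0)) {T..t}"
      by (subst has_integral_cong[where g = "\<lambda>s. F (z (s - T)) (\<delta> s)"]) auto
    from has_integral_combine[OF _ _ 1 2] show ?thesis
      using False x(3) by simp
  qed
  have "?\<phi> absolutely_integrable_on {0..t}"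
  proof (rule absolutely_integrable_integrable_bound)
    show "norm (?\<phi> s) \<le> B" if "s \<in> {0..t}" for s
      by (rule B[OF E[OF that] D[OF that]])
    show "?\<phi> integrable_on {0..t}" using int by blast
  qed (rule integrable_const_ivl)
  moreover have "(?y t, \<delta> t) \<in> \<Omega>"
    using ellipsoid_domain E[of t] D[of t] t by auto
  moreover have "?y t = ?y 0 + integral {0..t} ?\<phi>"
    using integral_unique[OF int] x(3) by simp
  ultimately show "(?y t, \<delta> t) \<in> \<Omega> \<and> ?\<phi> absolutely_integrable_on {0..t} \<and> ?y t = ?y 0 + integral {0..t} ?\<phi>"
    by blast
qed

text \<open>Uniqueness lets the local solutions agree on common intervals, so they glue to one on the union of
  their domains. If the union were bounded, the limit at its end would be in the ellipsoid, and the
  solution could be continued from there.\<close>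

lemma global_solution:
  assumes local_existence: "\<And>\<delta> x0. \<delta> \<in> admissible_params D \<Longrightarrow> x0 \<in> ellipsoid P 1 \<Longrightarrow>
        \<exists>T>0. \<exists>x. solution \<delta> {0..<T} x \<and> x 0 = x0"
    and uniqueness: "\<And>\<delta> T x z t. \<delta> \<in> admissible_params D \<Longrightarrow> x 0 \<in> ellipsoid P 1 \<Longrightarrow>
        solution \<delta> {0..<T} x \<Longrightarrow> solution \<delta> {0..<T} z \<Longrightarrow> z 0 = x 0 \<Longrightarrow> t \<in> {0..<T} \<Longrightarrow> x t = z t"
    and \<delta>: "\<delta> \<in> admissible_params D" and x0: "x0 \<in> ellipsoid P 1"
  shows "\<exists>x. solution \<delta> {0..} x \<and> x 0 = x0"
proof -
  define S where "S = {T. 0 < T \<and> (\<exists>x. solution \<delta> {0..<T} x \<and> x 0 = x0)}"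
  define X where "X T = (SOME x. solution \<delta> {0..<T} x \<and> x 0 = x0)" for T
  have X: "solution \<delta> {0..<T} (X T)" "X T 0 = x0" if "T \<in> S" for T
  proof -
    from that have "\<exists>x. solution \<delta> {0..<T} x \<and> x 0 = x0" by (simp add: S_def)
    then have "solution \<delta> {0..<T} (X T) \<and> X T 0 = x0" unfolding X_def by (rule someI_ex)
    then show "solution \<delta> {0..<T} (X T)" "X T 0 = x0" by simp_all
  qed
  obtain T0 where T0: "T0 \<in> S" "0 < T0"
    using local_existence[OF \<delta> x0] by (auto simp: S_def)
  have agree: "X T t = X T' t" if "T \<in> S" "T' \<in> S" "0 \<le> t" "t < T" "t < T'" for T T' t
  proof (rule uniqueness[OF \<delta>, of _ "min T T'"])
    show "solution \<delta> {0..<min T T'} (X T)" "solution \<delta> {0..<min T T'} (X T')"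
      using that(1,2) by (auto intro: solution_mono[OF X(1)])
  qed (use that x0 X(2) in auto)
  define x where "x t = X (SOME T. T \<in> S \<and> t < T) t" for t
  have x: "x t = X T t" if "T \<in> S" "0 \<le> t" "t < T" for t T
  proof -
    have "(SOME T. T \<in> S \<and> t < T) \<in> S \<and> t < (SOME T. T \<in> S \<and> t < T)"
      using that by (intro someI[of "\<lambda>T. T \<in> S \<and> t < T" T]) simp
    then show ?thesis unfolding x_def using that by (intro agree) auto
  qed
  have x_0: "x 0 = x0" using x[OF T0(1)] T0 X(2) by simp
  have sol: "solution \<delta> I x" if I: "I \<subseteq> {0..}" "\<And>t. t \<in> I \<Longrightarrow> \<exists>T\<in>S. t < T" for I
  proof (rule solution_cong[OF _ I(1)])
    fix t assume "t \<in> I"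
    then obtain T where T: "T \<in> S" "0 \<le> t" "t < T" using I by fastforce
    then have "solution \<delta> {t} (X T)" by (intro solution_mono[OF X(1)]) auto
    moreover have "\<forall>s\<in>{0..t}. x s = X T s" using T by (auto intro: x)
    ultimately show "\<exists>y. solution \<delta> {t} y \<and> (\<forall>s\<in>{0..t}. x s = y s)" by blast
  qed
  have "\<exists>T\<in>S. t < T" if "0 \<le> t" for t
  proof (rule ccontr)
    assume "\<not> (\<exists>T\<in>S. t < T)"
    then have bdd: "bdd_above S" by (auto simp: bdd_above_def not_less)
    define T where "T = Sup S"
    have "0 < T" using cSup_upper[OF T0(1) bdd] T0(2) by (simp add: T_def)
    have s: "solution \<delta> {0..<T} x"
    proof (rule sol)
      fix t assume "t \<in> {0..<T}"
      then show "\<exists>T\<in>S. t < T" using less_cSup_iff[OF _ bdd] T0(1) by (auto simp: T_def)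
    qed auto
    obtain xT where xT: "xT \<in> ellipsoid P 1" "((\<lambda>s. F (x s) (\<delta> s)) has_integral (xT - x 0)) {0..T}"
      using solution_endpoint[OF \<delta> s _ \<open>0 < T\<close>] x_0 x0 by blast
    have "(\<lambda>t. \<delta> (t + T)) \<in> admissible_params D"
      using \<delta> \<open>0 < T\<close> by (simp add: admissible_params_shift)
    then obtain \<tau> z where z: "0 < \<tau>" "solution (\<lambda>t. \<delta> (t + T)) {0..<\<tau>} z" "z 0 = xT"
      using local_existence xT(1) by blast
    have "solution \<delta> {0..<T + \<tau>} (\<lambda>t. if t < T then x t else z (t - T))"
      using xT z x_0 x0 by (intro solution_concat[OF \<delta> s _ \<open>0 < T\<close> z(2)]) auto
    then have "T + \<tau> \<in> S"
      using \<open>0 < T\<close> z(1) x_0 unfolding S_def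
      by (intro CollectI conjI exI[of _ "\<lambda>t. if t < T then x t else z (t - T)"]) auto
    then have "T + \<tau> \<le> T" unfolding T_def by (rule cSup_upper[OF _ bdd])
    then show False using z(1) by simp
  qed
  then have "solution \<delta> {0..} x" by (intro sol) auto
  then show ?thesis using x_0 by blast
qed

end

section \<open>The stabilization theorem\<close>

theorem theorem1:
  fixes \<Omega> :: "((real^'n) \<times> (real^'l)) set"
    and f :: "real^'n \<Rightarrow> real^'l \<Rightarrow> real^'n"
    and g :: "real^'n \<Rightarrow> real^'l \<Rightarrow> real^'m^'n"
    and h :: "real^'n \<Rightarrow> real^'l \<Rightarrow> real^'p"
    and ubar :: "real^'m" and V :: "(real^'m) set"
    and X :: "(real^'n) set" and D :: "(real^'l) set"
    and a :: "nat \<Rightarrow> real^'n" and n\<^sub>x\<^sub>e :: nat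
    and A1 :: "real^'n \<Rightarrow> real^'l \<Rightarrow> real^'n^'n"
    and A2 :: "real^'n \<Rightarrow> real^'l \<Rightarrow> real^'q^'n"
    and A3 :: "real^'n \<Rightarrow> real^'l \<Rightarrow> real^'m^'n"
    and \<Upsilon>1 :: "real^'n \<Rightarrow> real^'l \<Rightarrow> real^'n^'q"
    and \<Upsilon>2 :: "real^'n \<Rightarrow> real^'l \<Rightarrow> real^'q^'q"
    and \<Upsilon>3 :: "real^'n \<Rightarrow> real^'l \<Rightarrow> real^'m^'q"
    and C1 :: "real^'n^'p" and C2 :: "real^'q^'p"
    and \<pi> :: "real^'n \<Rightarrow> real^'m \<Rightarrow> real^'l \<Rightarrow> real^'q"
    and \<iota> :: "'r::finite \<Rightarrow> 'q::finite" and \<pi>x :: "real^'n \<Rightarrow> real^'r"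
    and \<Sigma>1 :: "real^'n \<Rightarrow> real^'l \<Rightarrow> real^'n^'r"
    and \<Sigma>2 :: "real^'n \<Rightarrow> real^'l \<Rightarrow> real^'r^'r"
    and P N :: "real^'n^'n" and R W :: "real^'m^'m" and Q :: "real^'p^'p"
    and S :: "real^'m^'p" and J :: "real^'q^('n + ('q + ('m + 'm)))"
    and Ls :: "real^'m^('p + 'm)" and Z :: "real^'r^'r"
    and Gbar :: "real^'n \<Rightarrow> real^'l \<Rightarrow> real^'n^'m"
    and G\<pi>bar :: "real^'n \<Rightarrow> real^'l \<Rightarrow> real^'r^'m"
    and K :: "real^'p^'m"
  \<comment> \<open>the saturated system\<close>
  assumes ubar: "\<forall>i. 0 < ubar $ i"
    and V: "0 \<in> V"
    and X: "polytope X" "0 \<in> X" "X = {x. \<forall>k\<in>{1..n\<^sub>x\<^sub>e}. a k \<bullet> x \<le> 1}"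
    and D: "polytope D"
    and \<Omega>: "open \<Omega>" "X \<times> D \<subseteq> \<Omega>"
    and rational: "rational_on \<Omega> (case_prod f)" "rational_on \<Omega> (case_prod g)"
                  "rational_on \<Omega> (case_prod h)"
    and smooth: "C1_on \<Omega> (case_prod f)" "C1_on \<Omega> (case_prod g)" "C1_on \<Omega> (case_prod h)"
    and equilibrium: "\<forall>\<delta>\<in>D. f 0 \<delta> = 0" "\<forall>\<delta>\<in>D. h 0 \<delta> = 0"
  \<comment> \<open>its differential algebraic representation\<close>
    and affine_dar: "affine_map (case_prod A1)" "affine_map (case_prod A2)"
                    "affine_map (case_prod A3)" "affine_map (case_prod \<Upsilon>1)"
                    "affine_map (case_prod \<Upsilon>2)" "affine_map (case_prod \<Upsilon>3)"
    and dar_dynamics: "\<forall>x\<in>X. \<forall>\<delta>\<in>D. \<forall>v\<in>V.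
          f x \<delta> + g x \<delta> *v sat ubar v
          = A1 x \<delta> *v x + A2 x \<delta> *v \<pi> x (sat ubar v) \<delta> + A3 x \<delta> *v sat ubar v"
    and dar_constraint: "\<forall>x\<in>X. \<forall>\<delta>\<in>D. \<forall>v\<in>V.
          0 = \<Upsilon>1 x \<delta> *v x + \<Upsilon>2 x \<delta> *v \<pi> x (sat ubar v) \<delta> + \<Upsilon>3 x \<delta> *v sat ubar v"
    and dar_output: "\<forall>x\<in>X. \<forall>\<delta>\<in>D. \<forall>v\<in>V. h x \<delta> = C1 *v x + C2 *v \<pi> x (sat ubar v) \<delta>"
    and \<Upsilon>2_invertible: "\<forall>x\<in>X. \<forall>\<delta>\<in>D. invertible (\<Upsilon>2 x \<delta>)"
    and \<pi>x: "inj \<iota>" "\<forall>x\<in>X. \<forall>\<delta>\<in>D. \<forall>v\<in>V. \<forall>j. \<pi> x (sat ubar v) \<delta> $ \<iota> j = \<pi>x x $ j"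
    and affine_\<Sigma>: "affine_map (case_prod \<Sigma>1)" "affine_map (case_prod \<Sigma>2)"
    and \<Sigma>_constraint: "\<forall>x\<in>X. \<forall>\<delta>\<in>D. 0 = \<Sigma>1 x \<delta> *v x + \<Sigma>2 x \<delta> *v \<pi>x x"
  \<comment> \<open>the decision variables and the matrix inequalities\<close>
    and pd: "pos_def P" "pos_def N" "pos_def R"
    and Q: "transpose Q = Q"
    and W: "pos_def W" "diagonal_mat W"
    and affine_G: "affine_map (case_prod Gbar)" "affine_map (case_prod G\<pi>bar)"
    and lmi1: "\<forall>x \<delta>. (x, \<delta>) extreme_point_of (X \<times> D) \<longrightarrow>
          neg_def (Phi_mat P N R Q W S (A1 x \<delta>) (A2 x \<delta>) (A3 x \<delta>) C1 C2
                     (Gbar x \<delta>) (pad_columns \<iota> (G\<pi>bar x \<delta>))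
                   + J ** Gamma_mat (\<Upsilon>1 x \<delta>) (\<Upsilon>2 x \<delta>) (\<Upsilon>3 x \<delta>)
                   + transpose (Gamma_mat (\<Upsilon>1 x \<delta>) (\<Upsilon>2 x \<delta>) (\<Upsilon>3 x \<delta>)) ** transpose J)"
    and lmi2: "\<forall>x \<delta>. (x, \<delta>) extreme_point_of (X \<times> D) \<longrightarrow> (\<forall>i.
          pos_semidef (sym_block P
            (Z ** \<Sigma>1 x \<delta> <~> rowvector (Gbar x \<delta> $ i))
            (sym_block (transpose (\<Sigma>2 x \<delta>) ** transpose Z + Z ** \<Sigma>2 x \<delta>)
               (rowvector (G\<pi>bar x \<delta> $ i))
               (mat (2 * W $ i $ i - 1 / (ubar $ i)\<^sup>2) :: real^1^1))))"
    and lmi3: "neg_def (sym_block Q (transpose S) R + He (Ls ** (transpose S <|> R)))"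
    and lmi4: "\<forall>k\<in>{1..n\<^sub>x\<^sub>e}. pos_semidef (sym_block P (rowvector (a k)) (mat 1 :: real^1^1))"
  \<comment> \<open>the gain, for which the closed loop has unique (local) solutions\<close>
    and K: "K = - (matrix_inv R ** transpose S)"
    and well_posed: "closed_loop_well_posed \<Omega> f g h ubar V K X D"
  shows "asymptotically_stable (\<lambda>\<delta> x. closed_loop_solution \<Omega> f g h ubar V K \<delta> {0..} x)
           (admissible_params D)
       \<and> (\<forall>\<delta>\<in>D. ellipsoid P 1 \<subseteq> X \<inter>
             sat_region ubar (\<lambda>x. matrix_inv W ** Gbar x \<delta>) (\<lambda>x. matrix_inv W ** G\<pi>bar x \<delta>) \<pi>x)
       \<and> attraction_estimate (\<lambda>\<delta> x. closed_loop_solution \<Omega> f g h ubar V K \<delta> {0..} x)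
           (admissible_params D) (ellipsoid P 1)"
proof -
  have sym: "transpose P = P" using pd(1) by (simp add: pos_def_def)
  have W_inv: "W *v (matrix_inv W *v u) = u" for u
    using pos_def_mult_matrix_inv[OF W(1)] by (simp add: matrix_vector_mul_assoc)
  have R_inv: "R *v (matrix_inv R *v u) = u" for u
    using pos_def_mult_matrix_inv[OF pd(3)] by (simp add: matrix_vector_mul_assoc)
  have K_eq: "R *v (K *v y) = - (transpose S *v y)" for y
    by (simp add: K R_inv uminus_matrix_vector_mult linear_neg[OF matrix_vector_mul_linear]
        del: transpose_matrix_vector flip: matrix_vector_mul_assoc)
  have EX: "ellipsoid P 1 \<subseteq> X"
    using ellipsoid_subset_halfspace lmi4 unfolding X(3) by blast

  \<comment> \<open>the auxiliary signal of the sector condition, which never exceeds the saturation levels in the ellipsoid\<close>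
  have \<theta>_bound: "\<bar>(matrix_inv W *v (Gbar x \<delta> *v x + G\<pi>bar x \<delta> *v \<pi>x x)) $ i\<bar> \<le> ubar $ i"
    if x: "x \<in> ellipsoid P 1" and \<delta>: "\<delta> \<in> D" for x \<delta> i
  proof (rule saturation_bound)
    have xX: "x \<in> X" using x EX by blast
    show "0 \<le> z \<bullet> (sym_block P (Z ** \<Sigma>1 x \<delta> <~> rowvector (Gbar x \<delta> $ i))
            (sym_block (transpose (\<Sigma>2 x \<delta>) ** transpose Z + Z ** \<Sigma>2 x \<delta>)
               (rowvector (G\<pi>bar x \<delta> $ i)) (mat (2 * W $ i $ i - 1 / (ubar $ i)\<^sup>2) :: real^1^1)) *v z)"
      if "z = x \<oplus>\<^sub>v \<pi>x x \<oplus>\<^sub>v vec s" for z s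
      using lmi2 by (intro saturation_lmi_on_polytope[OF X(1) D xX \<delta> affine_\<Sigma> affine_G _ that]) blast
    show "\<Sigma>1 x \<delta> *v x + \<Sigma>2 x \<delta> *v \<pi>x x = 0"
      using \<Sigma>_constraint xX \<delta> by simp
    show "x \<bullet> (P *v x) \<le> 1" using x by (simp add: ellipsoid_def)
    show "Gbar x \<delta> $ i \<bullet> x + G\<pi>bar x \<delta> $ i \<bullet> \<pi>x x
        = W $ i $ i * (matrix_inv W *v (Gbar x \<delta> *v x + G\<pi>bar x \<delta> *v \<pi>x x)) $ i"
      unfolding diagonal_mat_mult[OF W(2), symmetric] W_inv
      by (simp add: matrix_vector_mul_component)
  qed (use ubar pos_def_diagonal_pos[OF W(1)] in auto)

  define F where "F x \<delta> = f x \<delta> + g x \<delta> *v sat ubar (K *v h x \<delta>)" for x \<delta>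
  \<comment> \<open>a closed-loop trajectory from \<open>x\<close> under a constant parameter has its control in \<open>V\<close> at time \<open>0\<close>\<close>
  have control_values: "K *v h x \<delta> \<in> V" if xX: "x \<in> X" and \<delta>: "\<delta> \<in> D" for x \<delta>
  proof -
    obtain T y where "0 < T" "closed_loop_solution \<Omega> f g h ubar V K (\<lambda>t. \<delta>) {0..<T} y" "y 0 = x"
      using well_posed xX const_admissible_params[OF \<delta>] unfolding closed_loop_well_posed_def by blast
    from this(2) have "\<forall>t\<in>{0..<T}. K *v h (y t) \<delta> \<in> V"
      unfolding closed_loop_solution_def system_solution_def by blast
    from bspec[OF this, of 0] show ?thesis
      using \<open>0 < T\<close> \<open>y 0 = x\<close> by simp
  qed

  have dissipation: "2 * (x \<bullet> (P *v F x \<delta>)) \<le> - (x \<bullet> (N *v x))"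
    if x: "x \<in> ellipsoid P 1" and \<delta>: "\<delta> \<in> D" for x \<delta>
  proof -
    have xX: "x \<in> X" using x EX by blast
    let ?v = "K *v h x \<delta>" let ?p = "\<pi> x (sat ubar ?v) \<delta>"
    have v: "?v \<in> V" by (rule control_values[OF xX \<delta>])
    have h: "h x \<delta> = C1 *v x + C2 *v ?p" using dar_output xX \<delta> v by blast
    have "(\<chi> j. ?p $ \<iota> j) = \<pi>x x"
      using \<pi>x(2) xX \<delta> v by (simp add: vec_eq_iff)
    then have H: "pad_columns \<iota> (G\<pi>bar x \<delta>) *v ?p = G\<pi>bar x \<delta> *v \<pi>x x"
      by (simp add: pad_columns_mult[OF \<pi>x(1)])
    have "2 * (x \<bullet> (P *v (A1 x \<delta> *v x + A2 x \<delta> *v ?p + A3 x \<delta> *v sat ubar ?v))) \<le> - (x \<bullet> (N *v x))"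
    proof (rule saturated_dissipation[OF sym Q W ubar _ lmi3])
      show "z \<bullet> ((Phi_mat P N R Q W S (A1 x \<delta>) (A2 x \<delta>) (A3 x \<delta>) C1 C2
                     (Gbar x \<delta>) (pad_columns \<iota> (G\<pi>bar x \<delta>))
                   + J ** Gamma_mat (\<Upsilon>1 x \<delta>) (\<Upsilon>2 x \<delta>) (\<Upsilon>3 x \<delta>)
                   + transpose (Gamma_mat (\<Upsilon>1 x \<delta>) (\<Upsilon>2 x \<delta>) (\<Upsilon>3 x \<delta>)) ** transpose J) *v z) \<le> 0"
        if "z = x \<oplus>\<^sub>v ?p \<oplus>\<^sub>v ?v \<oplus>\<^sub>v (sat ubar ?v - ?v)" for z
        using lmi1 by (intro stability_lmi_on_polytope[OF X(1) D xX \<delta> affine_dar affine_G \<pi>x(1) sym Q _ that]) blast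
      show "\<Upsilon>1 x \<delta> *v x + \<Upsilon>2 x \<delta> *v ?p + \<Upsilon>3 x \<delta> *v sat ubar ?v = 0"
        using dar_constraint xX \<delta> v by metis
      show "R *v ?v = - (transpose S *v (C1 *v x + C2 *v ?p))"
        by (simp only: K_eq flip: h)
      show "Gbar x \<delta> *v x + pad_columns \<iota> (G\<pi>bar x \<delta>) *v ?p
          = W *v (matrix_inv W *v (Gbar x \<delta> *v x + G\<pi>bar x \<delta> *v \<pi>x x))"
        by (simp only: H W_inv)
      show "\<forall>i. \<bar>(matrix_inv W *v (Gbar x \<delta> *v x + G\<pi>bar x \<delta> *v \<pi>x x)) $ i\<bar> \<le> ubar $ i"
        using \<theta>_bound[OF x \<delta>] by blast
    qed
    then show ?thesis
      using dar_dynamics xX \<delta> v by (simp add: F_def)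
  qed

  interpret dissipative_system \<Omega> F D P N
  proof
    have c: "continuous_on \<Omega> (case_prod f)" "continuous_on \<Omega> (case_prod g)" "continuous_on \<Omega> (case_prod h)"
      using smooth by (auto intro: C1_on_imp_continuous_on)
    have "continuous_on \<Omega> (\<lambda>z. case_prod f z + case_prod g z *v sat ubar (K *v case_prod h z))"
      by (intro continuous_on_add continuous_on_matrix_vector_mult continuous_on_sat ubar
          continuous_on_const c)
    then show "continuous_on \<Omega> (case_prod F)"
      by (simp add: F_def case_prod_beta cong: continuous_on_cong)
    show "ellipsoid P 1 \<times> D \<subseteq> \<Omega>" using EX \<Omega>(2) by blast
  qed (use \<Omega>(1) D pd dissipation polytope_imp_compact in auto)

  let ?cl = "closed_loop_solution \<Omega> f g h ubar V K"
  have cl_solution: "solution \<delta> I x" if "?cl \<delta> I x" for \<delta> I x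
    using that unfolding closed_loop_solution_def system_solution_def solution_def F_def by blast
  \<comment> \<open>a solution from the ellipsoid stays in \<open>X\<close>, where feedback values lie in \<open>V\<close>\<close>
  have solution_cl: "?cl \<delta> I x"
    if \<delta>: "\<delta> \<in> admissible_params D" and x: "solution \<delta> I x" "x 0 \<in> ellipsoid P 1"
      and I: "I \<in> sets lebesgue" "I \<subseteq> {0..}" "\<And>t. t \<in> I \<Longrightarrow> {0..t} \<subseteq> I" for \<delta> I x
  proof -
    have "continuous_on \<Omega> (\<lambda>z. K *v case_prod h z)"
      by (intro continuous_on_matrix_vector_mult continuous_on_const C1_on_imp_continuous_on smooth)
    then have "continuous_on \<Omega> (\<lambda>(x, \<delta>). K *v h x \<delta>)"
      by (simp add: case_prod_beta)
    moreover have dom: "\<forall>t\<in>I. (x t, \<delta> t) \<in> \<Omega>"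
      using x(1) unfolding solution_def by blast
    ultimately have "(\<lambda>t. K *v h (x t) (\<delta> t)) \<in> borel_measurable (lebesgue_on I)"
      using \<delta> I(1,2) solution_continuous_on[OF \<delta> x(1) I(2,3)]
      by (intro measurable_along_trajectory[of \<delta> I x \<Omega> "\<lambda>x \<delta>. K *v h x \<delta>"]) (auto simp: admissible_params_def)
    moreover have "\<forall>t\<in>I. K *v h (x t) (\<delta> t) \<in> V"
    proof
      fix t assume t: "t \<in> I"
      then have "x t \<in> X" using ellipsoid_invariant[OF \<delta> x(1) I(2,3) t x(2)] EX by blast
      then show "K *v h (x t) (\<delta> t) \<in> V"
        using control_values \<delta> t I(2) by (auto simp: admissible_params_def)
    qed
    ultimately show ?thesis
      using x(1) dom
      unfolding closed_loop_solution_def system_solution_def solution_def F_def by blast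
  qed

  have global: "\<exists>x. ?cl \<delta> {0..} x \<and> x 0 = x0"
    if \<delta>: "\<delta> \<in> admissible_params D" and x0: "x0 \<in> ellipsoid P 1" for \<delta> x0
  proof -
    have "\<exists>x. solution \<delta> {0..} x \<and> x 0 = x0"
    proof (rule global_solution[OF _ _ \<delta> x0])
      show "\<exists>T>0. \<exists>x. solution \<delta> {0..<T} x \<and> x 0 = x0"
        if "\<delta> \<in> admissible_params D" "x0 \<in> ellipsoid P 1" for \<delta> x0
        using well_posed that EX unfolding closed_loop_well_posed_def by (meson cl_solution subsetD)
      show "x t = z t" if "\<delta> \<in> admissible_params D" "x 0 \<in> ellipsoid P 1"
        "solution \<delta> {0..<T} x" "solution \<delta> {0..<T} z" "z 0 = x 0" "t \<in> {0..<T}" for \<delta> T x z t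
      proof -
        have "?cl \<delta> {0..<T} x" "?cl \<delta> {0..<T} z"
          using that interval_initial by (intro solution_cl; simp)+
        moreover have "x 0 \<in> X" using EX that(2) by blast
        note well_posed[unfolded closed_loop_well_posed_def, THEN bspec, THEN bspec, THEN conjunct2,
            OF that(1) this, THEN spec[of _ T], THEN spec[of _ x], THEN spec[of _ z]]
        ultimately show ?thesis using that(5,6) by blast
      qed
    qed
    then obtain x where "solution \<delta> {0..} x" "x 0 = x0" by blast
    then have "?cl \<delta> {0..} x" using x0 by (intro solution_cl[OF \<delta>]) auto
    then show ?thesis using \<open>x 0 = x0\<close> by blast
  qed

  have attraction: "attraction_estimate (\<lambda>\<delta> x. ?cl \<delta> {0..} x) (admissible_params D) (ellipsoid P 1)"
    unfolding attraction_estimate_def using global solution_tendsto_zero cl_solution by blast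
  have "asymptotically_stable (\<lambda>\<delta> x. ?cl \<delta> {0..} x) (admissible_params D)"
    unfolding asymptotically_stable_def
  proof (intro conjI allI impI)
    fix e :: real assume "0 < e"
    then obtain r where "0 < r" "\<And>\<delta> x t. \<delta> \<in> admissible_params D \<Longrightarrow> solution \<delta> {0..} x \<Longrightarrow>
        norm (x 0) < r \<Longrightarrow> 0 \<le> t \<Longrightarrow> norm (x t) < e"
      using uniformly_stable by blast
    then show "\<exists>r>0. \<forall>\<delta>\<in>admissible_params D. \<forall>x. ?cl \<delta> {0..} x \<and> norm (x 0) < r \<longrightarrow> (\<forall>t\<ge>0. norm (x t) < e)"
      using cl_solution by blast
  next
    obtain r where "0 < r" "ball 0 r \<subseteq> ellipsoid P 1"
      using ball_in_ellipsoid by blast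
    then show "\<exists>r>0. attraction_estimate (\<lambda>\<delta> x. ?cl \<delta> {0..} x) (admissible_params D) (ball 0 r)"
      using attraction unfolding attraction_estimate_def by blast
  qed
  moreover have "\<forall>\<delta>\<in>D. ellipsoid P 1 \<subseteq> X \<inter>
      sat_region ubar (\<lambda>x. matrix_inv W ** Gbar x \<delta>) (\<lambda>x. matrix_inv W ** G\<pi>bar x \<delta>) \<pi>x"
  proof (intro ballI subsetI IntI)
    fix \<delta> x assume "\<delta> \<in> D" "x \<in> ellipsoid P 1"
    then show "x \<in> sat_region ubar (\<lambda>x. matrix_inv W ** Gbar x \<delta>) (\<lambda>x. matrix_inv W ** G\<pi>bar x \<delta>) \<pi>x"
      using \<theta>_bound[of x \<delta>]
      by (simp add: sat_region_def matrix_vector_right_distrib flip: matrix_vector_mul_assoc)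
  qed (use EX in blast)
  ultimately show ?thesis using attraction by blast
qed

end
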